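(* The operators $\mathcal{H}_\ell=\sum_{E\in\mathfrak{H}_\ell}X(E)^2$, $\ell=1,\dots,7$, acting on $\mathbb{S}^7$, pairwise commute. Moreover, they commute with the sublaplacian $\Delta^{\mathrm{sub}}_{\mathrm{T},4}=-\sum_{j=1}^4X(A_j)^2$.
   Context: Let $A_1,\dots,A_7\in\mathfrak{so}(8)$ be a fixed family of real skew-symmetric $8\times 8$ matrices with $A_iA_j+A_jA_i=-2\delta_{ij}I$ for $i,j=1,\dots,7$. For $A=(a_{lk})\in\mathfrak{so}(8)$ let $X(A)=\sum_{l,k=1}^8a_{lk}x_k\frac{\partial}{\partial x_l}$, a linear vector field on $\mathbb{R}^8$ tangent to the unit sphere $\mathbb{S}^7$; its restriction to $\mathbb{S}^7$ is denoted by the same symbol and regarded as a first order differential operator on $C^\infty(\mathbb{S}^7)$. The generating sets are $\mathfrak{H}_\ell=\{A_iA_j : 1\le i<j\le\ell+1\}$ for $1\le\ell\le3$; $\mathfrak{H}_4=\{A_iA_j : 1\le i<j\le4 \text{ or } (i,j)=(5,6)\}$; $\mathfrak{H}_5=\{A_iA_j : 1\le i<j\le4 \text{ or } 5\le i<j\le7\}$; $\mathfrak{H}_6=\mathfrak{H}_5\cup\{A_5,A_6,A_7\}$; $\mathfrak{H}_7=\{A_iA_j : 1\le i<j\le7\}\cup\{A_k : 1\le k\le7\}$. *)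

theory Defs
  imports "HOL-Analysis.Analysis"
begin

text \<open>Class C^k, meant for an open set U: f is differentiable and its derivative in every
  fixed direction is of class C^(k-1).\<close>

primrec Ck_on :: "nat \<Rightarrow> 'a::euclidean_space set \<Rightarrow> ('a \<Rightarrow> real) \<Rightarrow> bool" where
  "Ck_on 0 U f \<longleftrightarrow> continuous_on U f"
| "Ck_on (Suc k) U f \<longleftrightarrow>
     f differentiable_on U \<and> (\<forall>v. Ck_on k U (\<lambda>x. frechet_derivative f (at x) v))"

definition smooth_on :: "'a::euclidean_space set \<Rightarrow> ('a \<Rightarrow> real) \<Rightarrow> bool" where
  "smooth_on U f \<longleftrightarrow> (\<forall>k. Ck_on k U f)"

abbreviation S7 :: "(real^8) set" where
  "S7 \<equiv> sphere 0 1"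

text \<open>A function on the sphere is represented by a function on the ambient space of which only
  the values on \<^term>\<open>S7\<close> matter. As usual for embedded submanifolds, it is smooth if near
  each point it is the restriction of a smooth function on an open set.\<close>

definition smooth_extension_at ::
    "(real^8 \<Rightarrow> real) \<Rightarrow> real^8 \<Rightarrow> (real^8) set \<Rightarrow> (real^8 \<Rightarrow> real) \<Rightarrow> bool" where
  "smooth_extension_at f p U g \<longleftrightarrow>
     open U \<and> p \<in> U \<and> smooth_on U g \<and> (\<forall>q\<in>U \<inter> S7. g q = f q)"

definition C_infinity_S7 :: "(real^8 \<Rightarrow> real) set" where
  "C_infinity_S7 = {f. \<forall>p\<in>S7. \<exists>U g. smooth_extension_at f p U g}"

definition lin_vf :: "real^8^8 \<Rightarrow> (real^8 \<Rightarrow> real) \<Rightarrow> real^8 \<Rightarrow> real" where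
  "lin_vf A g x =
     (\<Sum>l\<in>UNIV. \<Sum>k\<in>UNIV. A $ l $ k * x $ k * frechet_derivative g (at x) (axis l 1))"

text \<open>The restriction of a tangential linear vector field to the sphere, acting on functions on
  the sphere. The value at p does not depend on the choice of the local extension g if A is
  skew-symmetric; see the lemma \<open>X_vf_eq_lin_vf\<close> below.\<close>

definition X_vf :: "real^8^8 \<Rightarrow> (real^8 \<Rightarrow> real) \<Rightarrow> real^8 \<Rightarrow> real" where
  "X_vf A f p = (if p \<in> S7
     then THE d. \<exists>U g. smooth_extension_at f p U g \<and> d = lin_vf A g p else 0)"

definition skew_symmetric :: "real^'n^'n \<Rightarrow> bool" where
  "skew_symmetric A \<longleftrightarrow> transpose A = - A"

lemma lin_vf_eq:
  assumes "g differentiable (at x)"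
  shows "lin_vf A g x = frechet_derivative g (at x) (A *v x)"
proof -
  interpret L: linear "frechet_derivative g (at x)"
    using linear_frechet_derivative[OF assms] .
  have "A *v x = (\<Sum>l\<in>UNIV. (A *v x) $ l *\<^sub>R axis l 1)"
    using basis_expansion[of "A *v x"] by (simp only: scalar_mult_eq_scaleR)
  then have "frechet_derivative g (at x) (A *v x)
      = frechet_derivative g (at x) (\<Sum>l\<in>UNIV. (A *v x) $ l *\<^sub>R axis l 1)"
    by (rule arg_cong)
  also have "\<dots> = lin_vf A g x"
    by (simp only: L.sum L.scaleR lin_vf_def matrix_vector_mult_def sum_distrib_right
        vec_lambda_beta real_scaleR_def)
  finally show ?thesis ..
qed

lemma smooth_on_differentiable:
  assumes "smooth_on U g" "open U" "p \<in> U"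
  shows "g differentiable (at p)"
proof -
  have "Ck_on (Suc 0) U g"
    using assms(1) unfolding smooth_on_def by blast
  then show ?thesis
    using assms(2,3) by (auto simp: differentiable_on_eq_differentiable_at)
qed

lemma skew_symmetric_inner:
  assumes "skew_symmetric A"
  shows "x \<bullet> (A *v x) = 0"
proof -
  have "x \<bullet> (A *v x) = (transpose A *v x) \<bullet> x"
    by (metis dot_lmul_matrix transpose_matrix_vector)
  also have "transpose A *v x = - (A *v x)"
    using assms by (simp add: skew_symmetric_def vec_eq_iff matrix_vector_mult_def sum_negf)
  also have "- (A *v x) \<bullet> x = - (x \<bullet> (A *v x))"
    by (simp add: inner_commute)
  finally show ?thesis by simp
qed

lemma tangential_derivative_unique:
  fixes g h :: "real^8 \<Rightarrow> real"
  assumes g: "g differentiable (at p)" and h: "h differentiable (at p)"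
    and U: "open U" "p \<in> U" and eq: "\<And>q. q \<in> U \<Longrightarrow> q \<in> S7 \<Longrightarrow> g q = h q"
    and p: "p \<in> S7" and v: "p \<bullet> v = 0"
  shows "frechet_derivative g (at p) v = frechet_derivative h (at p) v"
proof -
  define c where "c t = (1 / sqrt (1 + t\<^sup>2 * (norm v)\<^sup>2)) *\<^sub>R (p + t *\<^sub>R v)" for t :: real
  have pos: "1 + t\<^sup>2 * (norm v)\<^sup>2 > 0" for t :: real
    by (intro add_pos_nonneg mult_nonneg_nonneg) simp_all
  have c0: "c 0 = p" by (simp add: c_def)
  have n: "norm (p + t *\<^sub>R v) = sqrt (1 + t\<^sup>2 * (norm v)\<^sup>2)" for t
  proof -
    have "p \<bullet> p = 1" using p by (simp add: dot_square_norm)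
    moreover have "v \<bullet> p = 0" using v by (simp add: inner_commute)
    ultimately have "(p + t *\<^sub>R v) \<bullet> (p + t *\<^sub>R v) = 1 + t\<^sup>2 * (v \<bullet> v)"
      using v by (simp only: inner_add_left inner_add_right inner_scaleR_left inner_scaleR_right
          power2_eq_square) simp
    then have "(p + t *\<^sub>R v) \<bullet> (p + t *\<^sub>R v) = 1 + t\<^sup>2 * (norm v)\<^sup>2"
      by (simp only: dot_square_norm)
    then show ?thesis by (simp add: norm_eq_sqrt_inner)
  qed
  have cS: "c t \<in> S7" for t
    using pos[of t] by (simp add: c_def n)
  have r: "((\<lambda>t. 1 / sqrt (1 + t\<^sup>2 * (norm v)\<^sup>2)) has_real_derivative 0) (at 0)"
    by (auto intro!: derivative_eq_intros)
  have dc: "(c has_derivative (\<lambda>t. t *\<^sub>R v)) (at 0)"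
    unfolding c_def
    by (rule has_derivative_eq_rhs, rule has_derivative_scaleR)
      (auto intro!: derivative_eq_intros r[unfolded has_field_derivative_def])
  have along: "((\<lambda>t. k (c t)) has_derivative
      (\<lambda>t. frechet_derivative k (at p) (t *\<^sub>R v))) (at 0)"
    if "k differentiable (at p)" for k :: "real^8 \<Rightarrow> real"
    using diff_chain_at[OF dc, of k "frechet_derivative k (at p)"] that c0
    by (simp add: o_def frechet_derivative_works)
  have "isCont c 0"
    using has_derivative_continuous[OF dc] .
  then have "eventually (\<lambda>t. c t \<in> U) (nhds 0)"
    unfolding eventually_nhds continuous_at_open using U c0 by simp
  then have "eventually (\<lambda>t. g (c t) = h (c t)) (nhds 0)"
    by eventually_elim (use eq cS in auto)
  then obtain T where T: "open T" "0 \<in> T" "\<And>t. t \<in> T \<Longrightarrow> g (c t) = h (c t)"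
    unfolding eventually_nhds by blast
  have "((\<lambda>t. h (c t)) has_derivative (\<lambda>t. frechet_derivative g (at p) (t *\<^sub>R v))) (at 0)"
    using has_derivative_transform_within_open[OF along[OF g] T] .
  from fun_cong[OF has_derivative_unique[OF this along[OF h]], of 1] show ?thesis
    by simp
qed

lemma X_vf_eq_lin_vf:
  assumes A: "skew_symmetric A" and p: "p \<in> S7" and g: "smooth_extension_at f p U g"
  shows "X_vf A f p = lin_vf A g p"
proof -
  have "lin_vf A h p = lin_vf A g p" if h: "smooth_extension_at f p V h" for V h
  proof -
    have d: "h differentiable (at p)" "g differentiable (at p)"
      using g h smooth_on_differentiable unfolding smooth_extension_at_def by blast+
    have "frechet_derivative h (at p) (A *v p) = frechet_derivative g (at p) (A *v p)"
      using g h by (intro tangential_derivative_unique[where U="U \<inter> V"] d p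
          skew_symmetric_inner A) (auto simp: smooth_extension_at_def)
    then show ?thesis by (simp add: lin_vf_eq d)
  qed
  with g have "(THE d. \<exists>V h. smooth_extension_at f p V h \<and> d = lin_vf A h p) = lin_vf A g p"
    by (intro the_equality) blast+
  with p show ?thesis by (simp add: X_vf_def)
qed

definition generating_set :: "(nat \<Rightarrow> real^8^8) \<Rightarrow> nat \<Rightarrow> (real^8^8) set" where
  "generating_set A l =
    (if 1 \<le> l \<and> l \<le> 3 then {A i ** A j | i j. 1 \<le> i \<and> i < j \<and> j \<le> l + 1}
     else if l = 4 then {A i ** A j | i j. (1 \<le> i \<and> i < j \<and> j \<le> 4) \<or> (i, j) = (5, 6)}
     else if l = 5 then {A i ** A j | i j. (1 \<le> i \<and> i < j \<and> j \<le> 4) \<or> (5 \<le> i \<and> i < j \<and> j \<le> 7)}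
     else if l = 6 then {A i ** A j | i j. (1 \<le> i \<and> i < j \<and> j \<le> 4) \<or> (5 \<le> i \<and> i < j \<and> j \<le> 7)}
                        \<union> {A 5, A 6, A 7}
     else if l = 7 then {A i ** A j | i j. 1 \<le> i \<and> i < j \<and> j \<le> 7} \<union> {A k | k. 1 \<le> k \<and> k \<le> 7}
     else {})"

definition H_op :: "(nat \<Rightarrow> real^8^8) \<Rightarrow> nat \<Rightarrow> (real^8 \<Rightarrow> real) \<Rightarrow> real^8 \<Rightarrow> real" where
  "H_op A l f p = (\<Sum>E\<in>generating_set A l. X_vf E (X_vf E f) p)"

definition sublaplacian_T4 :: "(nat \<Rightarrow> real^8^8) \<Rightarrow> (real^8 \<Rightarrow> real) \<Rightarrow> real^8 \<Rightarrow> real" where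
  "sublaplacian_T4 A f p = - (\<Sum>j=1..4. X_vf (A j) (X_vf (A j) f) p)"

definition commute_on_S7 ::
    "((real^8 \<Rightarrow> real) \<Rightarrow> real^8 \<Rightarrow> real) \<Rightarrow> ((real^8 \<Rightarrow> real) \<Rightarrow> real^8 \<Rightarrow> real) \<Rightarrow> bool" where
  "commute_on_S7 P Q \<longleftrightarrow> (\<forall>f\<in>C_infinity_S7. \<forall>p\<in>S7. P (Q f) p = Q (P f) p)"

end

(* With A_8 = 1 the matrices e_ij = A_i A_j (i < j < 8) and e_i8 = A_i are the standard generators
   of so(8) = spin(8), and for a set I of indices the Casimir operator C(I) of the generators with
   indices in I commutes with C(J) whenever I and J are nested or disjoint. All operators in
   question are linear combinations of such Casimir operators; the only pair of blocks that
   overlap properly is {5,6,7,8}, from H_6, and {1,2,3,4,8}, from the sublaplacian. Here the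
   dimension enters: as A_1 ... A_7 acts as 1 or -1, A_1 A_2 A_3 A_4 has eigenspaces of dimension 4,
   on which both so(4) factors trace out the same orthogonal directions, so C({5,6,7,8}) and
   C({1,2,3,4}) are the same differential operator. *)

theory Submission
  imports Defs
begin

section \<open>Smooth functions and symmetry of second derivatives\<close>

text \<open>The calculus takes place on open sets of R^8. A field tangent to the sphere sends a
  function and its local extension to a function and an extension on the same neighbourhood, so each
  commutation reduces to one of linear vector fields on an open set, where brackets rest on the
  symmetry of second derivatives. The operators sum over sets of matrices, Casimir operators over
  index pairs; the generators must therefore be pairwise distinct. Nested or disjoint blocks commute
  because a pair of indices from the smaller block, or from the disjoint one, lies inside or outside
  the other block as a whole, and the sum of squares over a block is invariant under such
  generators. The agreement of the two so(4) blocks is an identity of differential operators rather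
  than of the Lie algebra: as the generators square to -1, their squared fields are Hessian terms
  minus one common radial derivative, and traces in two orthogonal frames of R^8 compare the Hessian
  terms.\<close>

lemma Ck_on_cong:
  assumes "open U" "Ck_on k U f" "\<And>x. x \<in> U \<Longrightarrow> f x = g x"
  shows "Ck_on k U g"
  using assms(2,3)
proof (induction k arbitrary: f g)
  case 0
  then show ?case using continuous_on_cong[of U U f g] by simp
next
  case (Suc k)
  have "f differentiable_on U" using Suc.prems(1) by simp
  then have "g differentiable_on U"
    unfolding differentiable_on_def
    using Suc.prems(2) by (auto intro: differentiable_transform_within[where d=1])
  have "frechet_derivative f (at x) = frechet_derivative g (at x)" if "x \<in> U" for x
    using \<open>f differentiable_on U\<close> that assms(1) Suc.prems(2)
    by (intro frechet_derivative_transform_within_open[of _ _ U])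
      (auto simp: differentiable_on_eq_differentiable_at)
  moreover have "Ck_on k U (\<lambda>x. frechet_derivative f (at x) v)" for v
    using Suc.prems(1) by simp
  ultimately have "Ck_on k U (\<lambda>x. frechet_derivative g (at x) v)" for v
    using Suc.IH[of "\<lambda>x. frechet_derivative f (at x) v" "\<lambda>x. frechet_derivative g (at x) v"]
    by simp
  with \<open>g differentiable_on U\<close> show ?case by simp
qed

lemma Ck_on_SucD: "Ck_on (Suc k) U f \<Longrightarrow> Ck_on k U f"
proof (induction k arbitrary: f)
  case 0
  then show ?case by (simp add: differentiable_imp_continuous_on)
next
  case (Suc k)
  then have "Ck_on k U (\<lambda>x. frechet_derivative f (at x) v)" for v
    by (metis Ck_on.simps(2))
  with Suc.prems show ?case by simp
qed

lemma Ck_on_const: "Ck_on k U (\<lambda>x. c)"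
  by (induction k arbitrary: c) simp_all

lemma Ck_on_bounded_linear:
  assumes "bounded_linear f"
  shows "Ck_on k U f"
proof (cases k)
  case 0
  then show ?thesis using assms by (simp add: linear_continuous_on)
next
  case (Suc n)
  have d: "(f has_derivative f) (at x)" for x
    by (simp add: assms bounded_linear_imp_has_derivative)
  then have "frechet_derivative f (at x) v = f v" for x v
    using fun_cong[OF frechet_derivative_at[OF d[of x]]] by simp
  moreover have "f differentiable_on U"
    unfolding differentiable_on_def differentiable_def using d has_derivative_at_withinI by blast
  ultimately show ?thesis
    by (simp add: Suc Ck_on_const)
qed

lemma frechet_derivative_add_mult:
  fixes f g :: "'a::euclidean_space \<Rightarrow> real"
  assumes "f differentiable (at x)" "g differentiable (at x)"
  shows "frechet_derivative (\<lambda>x. f x + g x) (at x) v =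
      frechet_derivative f (at x) v + frechet_derivative g (at x) v"
    and "frechet_derivative (\<lambda>x. f x * g x) (at x) v =
      f x * frechet_derivative g (at x) v + frechet_derivative f (at x) v * g x"
proof -
  have "(f has_derivative frechet_derivative f (at x)) (at x)"
    "(g has_derivative frechet_derivative g (at x)) (at x)"
    using assms by (simp_all add: frechet_derivative_works)
  from has_derivative_add[OF this, THEN frechet_derivative_at, THEN fun_cong[of _ _ v]]
    has_derivative_mult[OF this, THEN frechet_derivative_at, THEN fun_cong[of _ _ v]]
  show "frechet_derivative (\<lambda>x. f x + g x) (at x) v =
      frechet_derivative f (at x) v + frechet_derivative g (at x) v"
    "frechet_derivative (\<lambda>x. f x * g x) (at x) v =
      f x * frechet_derivative g (at x) v + frechet_derivative f (at x) v * g x"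
    by simp_all
qed

lemma Ck_on_add:
  assumes "open U" "Ck_on k U f" "Ck_on k U g"
  shows "Ck_on k U (\<lambda>x. f x + g x)"
  using assms(2,3)
proof (induction k arbitrary: f g)
  case 0
  then show ?case by (simp add: continuous_on_add)
next
  case (Suc k)
  then have d: "f differentiable (at x)" "g differentiable (at x)" if "x \<in> U" for x
    using that assms(1) by (simp_all add: differentiable_on_eq_differentiable_at)
  have "Ck_on k U (\<lambda>x. frechet_derivative (\<lambda>x. f x + g x) (at x) v)" for v
  proof (rule Ck_on_cong[OF assms(1)])
    show "Ck_on k U (\<lambda>x. frechet_derivative f (at x) v + frechet_derivative g (at x) v)"
      using Suc.prems by (intro Suc.IH) simp_all
  qed (simp add: d frechet_derivative_add_mult)
  then show ?case
    using Suc.prems by (simp add: differentiable_on_add)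
qed

lemma Ck_on_mult:
  assumes "open U" "Ck_on k U f" "Ck_on k U g"
  shows "Ck_on k U (\<lambda>x. f x * g x)"
  using assms(2,3)
proof (induction k arbitrary: f g)
  case 0
  then show ?case by (simp add: continuous_on_mult)
next
  case (Suc k)
  then have d: "f differentiable (at x)" "g differentiable (at x)" if "x \<in> U" for x
    using that assms(1) by (simp_all add: differentiable_on_eq_differentiable_at)
  have "Ck_on k U (\<lambda>x. frechet_derivative (\<lambda>x. f x * g x) (at x) v)" for v
  proof (rule Ck_on_cong[OF assms(1)])
    show "Ck_on k U (\<lambda>x. f x * frechet_derivative g (at x) v
        + frechet_derivative f (at x) v * g x)"
      \<comment> \<open>The product rule leaves one factor undifferentiated; its class is lowered
        from k + 1 to k before the induction hypothesis applies.\<close>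
      using Suc.prems Suc.prems[THEN Ck_on_SucD]
      by (intro Ck_on_add[OF assms(1)] Suc.IH) simp_all
  qed (simp add: d frechet_derivative_add_mult)
  then show ?case
    using Suc.prems by (simp add: differentiable_on_mult)
qed

lemma smooth_on_cong: "open U \<Longrightarrow> smooth_on U f \<Longrightarrow> (\<And>x. x \<in> U \<Longrightarrow> f x = g x) \<Longrightarrow> smooth_on U g"
  unfolding smooth_on_def using Ck_on_cong by blast

lemma smooth_on_const: "smooth_on U (\<lambda>x. c)"
  by (simp add: smooth_on_def Ck_on_const)

lemma smooth_on_bounded_linear: "bounded_linear f \<Longrightarrow> smooth_on U f"
  by (simp add: smooth_on_def Ck_on_bounded_linear)

lemma smooth_on_add: "open U \<Longrightarrow> smooth_on U f \<Longrightarrow> smooth_on U g \<Longrightarrow> smooth_on U (\<lambda>x. f x + g x)"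
  by (simp add: smooth_on_def Ck_on_add)

lemma smooth_on_mult: "open U \<Longrightarrow> smooth_on U f \<Longrightarrow> smooth_on U g \<Longrightarrow> smooth_on U (\<lambda>x. f x * g x)"
  by (simp add: smooth_on_def Ck_on_mult)

lemma smooth_on_sum:
  "open U \<Longrightarrow> (\<And>i. i \<in> I \<Longrightarrow> smooth_on U (f i)) \<Longrightarrow> smooth_on U (\<lambda>x. \<Sum>i\<in>I. f i x)"
  by (induction I rule: infinite_finite_induct) (auto simp: smooth_on_const smooth_on_add)

lemma smooth_on_frechet_derivative:
  "smooth_on U f \<Longrightarrow> smooth_on U (\<lambda>x. frechet_derivative f (at x) v)"
  unfolding smooth_on_def by (metis Ck_on.simps(2))

lemma smooth_on_continuous_on: "smooth_on U f \<Longrightarrow> continuous_on U f"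
  unfolding smooth_on_def by (metis Ck_on.simps(1))

section \<open>Symmetry of second derivatives through second differences\<close>

lemma DERIV_along_line:
  fixes k :: "'a::euclidean_space \<Rightarrow> real"
  assumes "k differentiable (at (y + s *\<^sub>R v))"
  shows "DERIV (\<lambda>s. k (y + s *\<^sub>R v)) s :> frechet_derivative k (at (y + s *\<^sub>R v)) v"
proof -
  let ?k = "frechet_derivative k (at (y + s *\<^sub>R v))"
  have "((\<lambda>s. y + s *\<^sub>R v) has_derivative (\<lambda>t. t *\<^sub>R v)) (at s)"
    by (auto intro!: derivative_eq_intros)
  from diff_chain_at[OF this, of k ?k] assms
  have "((\<lambda>s. k (y + s *\<^sub>R v)) has_derivative (\<lambda>t. ?k (t *\<^sub>R v))) (at s)"
    by (simp add: frechet_derivative_works o_def)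
  moreover have "?k (t *\<^sub>R v) = ?k v * t" for t
    using linear_frechet_derivative[OF assms] by (simp add: linear_cmul)
  ultimately show ?thesis
    by (simp add: has_field_derivative_def)
qed

text \<open>The second difference is the increment along \<open>v\<close> of a first difference
  along \<open>w\<close>. One mean value theorem per direction turns it into a mixed derivative, and
  the bound on \<open>t\<close> keeps the parallelogram inside the ball.\<close>

lemma second_difference_mean_value:
  fixes g :: "'a::euclidean_space \<Rightarrow> real"
  assumes U: "open U" and g: "smooth_on U g" and t: "0 < t"
    and ball: "ball x r \<subseteq> U" and r: "t * (norm v + norm w) < r"
  shows "\<exists>\<xi>\<in>ball x r. g (x + t *\<^sub>R v + t *\<^sub>R w) - g (x + t *\<^sub>R v) - g (x + t *\<^sub>R w) + g x =
    t\<^sup>2 * frechet_derivative (\<lambda>y. frechet_derivative g (at y) v) (at \<xi>) w"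
proof -
  have near: "x + s *\<^sub>R v + s' *\<^sub>R w \<in> ball x r" if "0 \<le> s" "s \<le> t" "0 \<le> s'" "s' \<le> t" for s s'
  proof -
    have "norm (s *\<^sub>R v + s' *\<^sub>R w) \<le> s * norm v + s' * norm w"
      using that norm_triangle_ineq[of "s *\<^sub>R v" "s' *\<^sub>R w"] by simp
    also have "\<dots> \<le> t * norm v + t * norm w"
      using that by (intro add_mono mult_right_mono) auto
    also have "\<dots> < r" using r by (simp add: algebra_simps)
    finally show ?thesis
      by (simp add: dist_norm norm_minus_commute add.assoc add.commute)
  qed
  have d: "k differentiable (at y)" if "smooth_on U k" "y \<in> ball x r" for k y
    using smooth_on_differentiable[OF that(1) U] that(2) ball by blast
  define \<phi> where "\<phi> s = g (x + t *\<^sub>R w + s *\<^sub>R v) - g (x + s *\<^sub>R v)" for s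
  have "DERIV \<phi> s :> frechet_derivative g (at (x + t *\<^sub>R w + s *\<^sub>R v)) v
      - frechet_derivative g (at (x + s *\<^sub>R v)) v" if "0 \<le> s" "s \<le> t" for s
    unfolding \<phi>_def using near[of s t] near[of s 0] that t
    by (intro DERIV_diff DERIV_along_line d[OF g]) (auto simp: algebra_simps)
  from MVT2[OF t this] obtain s where s: "0 < s" "s < t"
    and "\<phi> t - \<phi> 0 = t * (frechet_derivative g (at (x + t *\<^sub>R w + s *\<^sub>R v)) v
      - frechet_derivative g (at (x + s *\<^sub>R v)) v)"
    by auto
  moreover define \<psi> where "\<psi> s' = frechet_derivative g (at (x + s *\<^sub>R v + s' *\<^sub>R w)) v" for s'
  ultimately have 1: "\<phi> t - \<phi> 0 = t * (\<psi> t - \<psi> 0)"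
    by (simp add: algebra_simps)
  have "DERIV \<psi> s' :> frechet_derivative (\<lambda>y. frechet_derivative g (at y) v)
      (at (x + s *\<^sub>R v + s' *\<^sub>R w)) w" if "0 \<le> s'" "s' \<le> t" for s'
    unfolding \<psi>_def using near[of s s'] that s
    by (intro DERIV_along_line d smooth_on_frechet_derivative g) auto
  from MVT2[OF t this] obtain s' where s': "0 < s'" "s' < t"
    and 2: "\<psi> t - \<psi> 0 = t * frechet_derivative (\<lambda>y. frechet_derivative g (at y) v)
      (at (x + s *\<^sub>R v + s' *\<^sub>R w)) w"
    by auto
  have "g (x + t *\<^sub>R v + t *\<^sub>R w) - g (x + t *\<^sub>R v) - g (x + t *\<^sub>R w) + g x = \<phi> t - \<phi> 0"
    by (simp add: \<phi>_def algebra_simps)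
  with 1 2 show ?thesis
    using near[of s s'] s s'
    by (intro bexI[of _ "x + s *\<^sub>R v + s' *\<^sub>R w"]) (auto simp: power2_eq_square)
qed

text \<open>The second difference is symmetric in \<open>v\<close> and \<open>w\<close>, so one
  mixed derivative at some \<open>\<xi>\<close> equals the other at some \<open>\<eta>\<close>, both
  points close to \<open>x\<close>; continuity excludes a gap at \<open>x\<close>.\<close>

lemma second_derivative_symmetric:
  fixes g :: "'a::euclidean_space \<Rightarrow> real"
  assumes U: "open U" "x \<in> U" and g: "smooth_on U g"
  shows "frechet_derivative (\<lambda>y. frechet_derivative g (at y) v) (at x) w =
    frechet_derivative (\<lambda>y. frechet_derivative g (at y) w) (at x) v"
proof (rule ccontr)
  define a where
    "a v w y = frechet_derivative (\<lambda>y. frechet_derivative g (at y) v) (at y) w" for v w y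
  assume "\<not> ?thesis"
  then have ne: "dist (a v w x) (a w v x) > 0" by (simp add: a_def)
  \<comment> \<open>Half the supposed gap: values within this distance of the two sides cannot
    coincide.\<close>
  define e where "e = dist (a v w x) (a w v x) / 2"
  have "continuous_on U (a v w)" for v w
    unfolding a_def by (intro smooth_on_continuous_on smooth_on_frechet_derivative g)
  then have "\<exists>d>0. \<forall>y. dist y x < d \<longrightarrow> dist (a v w y) (a v w x) < e" for v w
    using U ne unfolding e_def
    by (auto simp: continuous_on_eq_continuous_at continuous_at_eps_delta simp del: less_divide_eq_numeral1)
  then obtain d1 d2 where d: "d1 > 0" "d2 > 0"
    "\<And>y. dist y x < d1 \<Longrightarrow> dist (a v w y) (a v w x) < e"
    "\<And>y. dist y x < d2 \<Longrightarrow> dist (a w v y) (a w v x) < e"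
    by metis
  obtain r0 where r0: "r0 > 0" "ball x r0 \<subseteq> U"
    using U openE by blast
  define r where "r = min r0 (min d1 d2)"
  have r: "r > 0" "ball x r \<subseteq> U" using r0 d(1,2) by (auto simp: r_def)
  \<comment> \<open>The summand 1 keeps the denominator positive for \<open>v = w = 0\<close> and
    makes the bound by \<open>r\<close> strict.\<close>
  define t where "t = r / (norm v + norm w + 1)"
  have N: "norm v + norm w + 1 > 0" by (smt (verit) norm_ge_zero)
  have "t > 0" unfolding t_def using r(1) N by simp
  have "t * (norm v + norm w + 1) = r" using N by (simp add: t_def)
  then have tr: "t * (norm v + norm w) < r" "t * (norm w + norm v) < r"
    using \<open>t > 0\<close> by (simp_all add: algebra_simps)
  obtain \<xi> where \<xi>: "\<xi> \<in> ball x r"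
    "g (x + t *\<^sub>R v + t *\<^sub>R w) - g (x + t *\<^sub>R v) - g (x + t *\<^sub>R w) + g x = t\<^sup>2 * a v w \<xi>"
    unfolding a_def using second_difference_mean_value[OF U(1) g \<open>t > 0\<close> r(2) tr(1)] by blast
  obtain \<eta> where \<eta>: "\<eta> \<in> ball x r"
    "g (x + t *\<^sub>R w + t *\<^sub>R v) - g (x + t *\<^sub>R w) - g (x + t *\<^sub>R v) + g x = t\<^sup>2 * a w v \<eta>"
    unfolding a_def using second_difference_mean_value[OF U(1) g \<open>t > 0\<close> r(2) tr(2)] by blast
  have "t\<^sup>2 * a v w \<xi> = t\<^sup>2 * a w v \<eta>"
    using \<xi>(2) \<eta>(2) by (simp add: algebra_simps)
  then have "a v w \<xi> = a w v \<eta>" using \<open>t > 0\<close> by simp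
  moreover have "dist (a v w \<xi>) (a v w x) < e" "dist (a w v \<eta>) (a w v x) < e"
    using d(3,4) \<xi>(1) \<eta>(1) by (auto simp: r_def dist_commute)
  ultimately show False
    unfolding e_def by (metis dist_commute dist_triangle_half_r less_irrefl)
qed

section \<open>Clifford families and generators of so(8)\<close>

lemma bilinear_eq_sum_axis:
  fixes b :: "real^'n \<Rightarrow> real^'n \<Rightarrow> real"
  assumes "bilinear b"
  shows "b x y = (\<Sum>r\<in>UNIV. \<Sum>s\<in>UNIV. x $ r * y $ s * b (axis r 1) (axis s 1))"
proof -
  have e: "z = (\<Sum>r\<in>UNIV. (z $ r) *\<^sub>R axis r 1)" for z :: "real^'n"
    using basis_expansion[of z] by (simp only: scalar_mult_eq_scaleR)
  have "b x y = b (\<Sum>r\<in>UNIV. (x $ r) *\<^sub>R axis r 1) (\<Sum>r\<in>UNIV. (y $ r) *\<^sub>R axis r 1)"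
    using e[of x] e[of y] by simp
  also have "\<dots> = (\<Sum>r\<in>UNIV. \<Sum>s\<in>UNIV. x $ r * y $ s * b (axis r 1) (axis s 1))"
    by (simp add: bilinear_sum[OF assms] bilinear_lmul[OF assms] bilinear_rmul[OF assms]
        sum.cartesian_product mult_ac)
  finally show ?thesis .
qed

text \<open>The trace of a bilinear form is independent of the orthonormal basis. A square matrix
  with orthonormal rows has orthonormal columns, and this completeness relation collapses the double
  sum in coordinates.\<close>

lemma sum_bilinear_orthonormal:
  fixes b :: "real^'n \<Rightarrow> real^'n \<Rightarrow> real" and v :: "'i \<Rightarrow> real^'n"
  assumes b: "bilinear b" and I: "finite I" "card I = CARD('n)"
    and v: "\<And>i j. i \<in> I \<Longrightarrow> j \<in> I \<Longrightarrow> v i \<bullet> v j = (if i = j then 1 else 0)"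
  shows "(\<Sum>i\<in>I. b (v i) (v i)) = (\<Sum>r\<in>UNIV. b (axis r 1) (axis r 1))"
proof -
  obtain h where h: "bij_betw h (UNIV :: 'n set) I"
    using finite_same_card_bij[of "UNIV :: 'n set" I] I by auto
  have hI: "h a \<in> I" for a using bij_betwE[OF h] by simp
  have h_eq: "h a = h c \<longleftrightarrow> a = c" for a c
    using bij_betw_imp_inj_on[OF h] by (rule inj_eq)
  define M where "M = (\<chi> a. v (h a))"
  have "M ** transpose M = mat 1"
    using v[OF hI hI] h_eq
    by (simp add: M_def matrix_matrix_mult_def transpose_def mat_def vec_eq_iff inner_vec_def)
  then have "transpose M ** M = mat 1"
    using matrix_left_right_inverse by blast
  then have M: "(\<Sum>a\<in>UNIV. v (h a) $ r * v (h a) $ s) = (if r = s then 1 else 0)" for r s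
    by (simp add: M_def matrix_matrix_mult_def transpose_def mat_def vec_eq_iff)
  have "(\<Sum>i\<in>I. b (v i) (v i)) = (\<Sum>a\<in>UNIV. b (v (h a)) (v (h a)))"
    by (rule sum.reindex_bij_betw[OF h, symmetric])
  also have "\<dots> = (\<Sum>a\<in>UNIV. \<Sum>r\<in>UNIV. \<Sum>s\<in>UNIV.
      v (h a) $ r * v (h a) $ s * b (axis r 1) (axis s 1))"
    by (subst bilinear_eq_sum_axis[OF b]) simp
  also have "\<dots> = (\<Sum>r\<in>UNIV. \<Sum>s\<in>UNIV. \<Sum>a\<in>UNIV.
      v (h a) $ r * v (h a) $ s * b (axis r 1) (axis s 1))"
    by (subst sum.swap, rule sum.cong[OF refl], rule sum.swap)
  also have "\<dots> = (\<Sum>r\<in>UNIV. \<Sum>s\<in>UNIV. (if r = s then 1 else 0) * b (axis r 1) (axis s 1))"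
    by (simp only: M flip: sum_distrib_right)
  also have "\<dots> = (\<Sum>r\<in>UNIV. b (axis r 1) (axis r 1))"
    by (simp add: if_distrib[of "\<lambda>z. z * _"] cong: if_cong)
  finally show ?thesis .
qed

text \<open>Meant for frames such as \<open>B i *v x\<close>, all of whose vectors have the length
  of \<open>x\<close>. The case \<open>c = 0\<close> is included so that a vanishing eigencomponent
  of a vector is covered.\<close>

lemma sum_bilinear_orthogonal:
  fixes b :: "real^'n \<Rightarrow> real^'n \<Rightarrow> real" and v :: "'i \<Rightarrow> real^'n"
  assumes b: "bilinear b" and I: "finite I" "card I = CARD('n)"
    and v: "\<And>i j. i \<in> I \<Longrightarrow> j \<in> I \<Longrightarrow> v i \<bullet> v j = (if i = j then c else 0)"
  shows "(\<Sum>i\<in>I. b (v i) (v i)) = c * (\<Sum>r\<in>UNIV. b (axis r 1) (axis r 1))"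
proof (cases "c = 0")
  case True
  then have "v i = 0" if "i \<in> I" for i using v[OF that that] by simp
  then show ?thesis using True by (simp add: bilinear_lzero[OF b])
next
  case False
  obtain i where "i \<in> I" using I by fastforce
  then have c: "c > 0" using v[of i i] False by (metis inner_ge_zero order_less_le)
  have "(\<Sum>i\<in>I. b ((1 / sqrt c) *\<^sub>R v i) ((1 / sqrt c) *\<^sub>R v i))
      = (\<Sum>r\<in>UNIV. b (axis r 1) (axis r 1))"
    using c v by (intro sum_bilinear_orthonormal[OF b I]) auto
  moreover have "b ((1 / sqrt c) *\<^sub>R v i) ((1 / sqrt c) *\<^sub>R v i) = b (v i) (v i) / c" for i
    using c by (simp add: bilinear_lmul[OF b] bilinear_rmul[OF b])
  ultimately show ?thesis
    using c by (simp add: field_simps flip: sum_divide_distrib)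
qed

section \<open>Hurwitz-Radon matrices and the bracket relations of so(8)\<close>

definition unit_extend :: "(nat \<Rightarrow> real^8^8) \<Rightarrow> nat \<Rightarrow> real^8^8" where
  "unit_extend A i = (if i = 8 then mat 1 else A i)"

text \<open>The transpose lets the identity at index 8 and the skew matrices be treated alike. Under
  the Clifford relations the diagonal term makes \<open>so8_gen A i i\<close> vanish, so
  antisymmetry holds for all index pairs.\<close>

definition so8_gen :: "(nat \<Rightarrow> real^8^8) \<Rightarrow> nat \<Rightarrow> nat \<Rightarrow> real^8^8" where
  "so8_gen A i j =
     (if i = j then mat 1 else 0) - transpose (unit_extend A i) ** unit_extend A j"

lemma matrix_mult_minus:
  fixes M N :: "real^'n^'n"
  shows "(- M) ** N = - (M ** N)" "M ** (- N) = - (M ** N)"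
  by (simp_all add: vec_eq_iff matrix_matrix_mult_def sum_negf)

lemma matrix_mult_diff:
  fixes M N K :: "real^'n^'n"
  shows "(M - N) ** K = M ** K - N ** K" "K ** (M - N) = K ** M - K ** N"
  by (simp_all add: vec_eq_iff matrix_matrix_mult_def sum_subtractf algebra_simps)

lemma matrix_mult_scaleR:
  fixes M N :: "real^'n^'n"
  shows "(c *\<^sub>R M) ** N = c *\<^sub>R (M ** N)" "M ** (c *\<^sub>R N) = c *\<^sub>R (M ** N)"
  by (simp_all add: vec_eq_iff matrix_matrix_mult_def sum_distrib_left algebra_simps)

lemma matrix_vector_neg: "(- M) *v x = - (M *v x)" for M :: "real^'n^'m"
  by (simp add: vec_eq_iff matrix_vector_mult_def sum_negf)

lemma transpose_diff:
  "transpose (M - N) = transpose M - (transpose N :: real^'n^'n)"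
  by (simp add: vec_eq_iff transpose_def)

locale clifford_family =
  fixes A :: "nat \<Rightarrow> real^8^8"
  assumes skew: "i \<in> {1..7} \<Longrightarrow> skew_symmetric (A i)"
    and clifford: "i \<in> {1..7} \<Longrightarrow> j \<in> {1..7} \<Longrightarrow>
      A i ** A j + A j ** A i = (- 2 * (if i = j then 1 else 0)) *\<^sub>R mat 1"
begin

abbreviation "B \<equiv> unit_extend A"
abbreviation "e \<equiv> so8_gen A"

lemma transpose_A: "i \<in> {1..7} \<Longrightarrow> transpose (A i) = - A i"
  using skew by (simp add: skew_symmetric_def)

lemma B_cases:
  assumes "i \<in> {1..8}"
  obtains "i \<in> {1..7}" "B i = A i" "transpose (B i) = - A i"
  | "i = 8" "B i = mat 1" "transpose (B i) = mat 1"
  using assms by (cases "i = 8") (auto simp: unit_extend_def transpose_A)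

lemma A_square: "i \<in> {1..7} \<Longrightarrow> A i ** A i = - mat 1"
  using clifford[of i i] by (simp add: vec_eq_iff)

lemma A_anticommute:
  assumes "i \<in> {1..7}" "j \<in> {1..7}" "i \<noteq> j"
  shows "A i ** A j = - (A j ** A i)"
  using clifford[of i j] assms by (simp add: eq_neg_iff_add_eq_0)

text \<open>The first form exchanges the indices of a generator; the second exchanges the two inner
  factors in a product of two generators.\<close>

lemma hurwitz_radon:
  assumes "i \<in> {1..8}" "j \<in> {1..8}"
  shows "transpose (B i) ** B j = (if i = j then 2 else 0) *\<^sub>R mat 1 - transpose (B j) ** B i"
    and "B i ** transpose (B j) = (if i = j then 2 else 0) *\<^sub>R mat 1 - B j ** transpose (B i)"
  by (rule B_cases[OF assms(1)]; rule B_cases[OF assms(2)];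
      cases "i = j"; force simp: matrix_mult_minus A_square A_anticommute[of i j] scaleR_2)+

lemma e_swap: "i \<in> {1..8} \<Longrightarrow> j \<in> {1..8} \<Longrightarrow> e j i = - e i j"
  using hurwitz_radon(1)[of i j] by (auto simp: so8_gen_def scaleR_2)

lemma e_refl: "i \<in> {1..8} \<Longrightarrow> e i i = 0"
  using e_swap[of i i] by (simp add: vec_eq_iff)

lemma e_skew:
  assumes "i \<in> {1..8}" "j \<in> {1..8}"
  shows "skew_symmetric (e i j)"
proof -
  have "transpose (e i j) = e j i"
    by (auto simp: so8_gen_def transpose_diff matrix_transpose_mul transpose_mat)
      (simp_all add: vec_eq_iff transpose_def)
  then show ?thesis
    using e_swap[OF assms] by (simp add: skew_symmetric_def)
qed

lemma e_A:
  assumes "i \<in> {1..7}" "j \<in> {1..7}" "i \<noteq> j"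
  shows "e i j = A i ** A j"
  using assms by (simp add: so8_gen_def unit_extend_def transpose_A matrix_mult_minus)

lemma e_A8:
  assumes "i \<in> {1..7}"
  shows "e i 8 = A i"
  using assms by (simp add: so8_gen_def unit_extend_def transpose_A matrix_mult_minus)

text \<open>These are the structure constants of so(8). Four exchanges by the Hurwitz-Radon
  relations reverse the order of \<open>G i j\<close> and \<open>G k l\<close>, each leaving a delta
  term; the identity parts of \<open>e\<close> commute with everything, and the delta products that
  they contribute cancel.\<close>

lemma e_bracket:
  assumes "i \<in> {1..8}" "j \<in> {1..8}" "k \<in> {1..8}" "l \<in> {1..8}"
  shows "e i j ** e k l - e k l ** e i j =
    (if j = k then - 2 else 0) *\<^sub>R e i l + (if i = k then 2 else 0) *\<^sub>R e j l
    + (if j = l then - 2 else 0) *\<^sub>R e k i + (if i = l then 2 else 0) *\<^sub>R e k j"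
proof -
  define G where "G i j = transpose (B i) ** B j" for i j
  define d where "d i j = (if i = j then 1 else 0 :: real)" for i j :: nat
  have sw: "G i j = (2 * d i j) *\<^sub>R mat 1 - G j i" if "i \<in> {1..8}" "j \<in> {1..8}" for i j
    using hurwitz_radon(1)[OF that] by (simp add: G_def d_def)
  have mid: "G i j ** G k l = (2 * d j k) *\<^sub>R G i l - G i k ** G j l"
    if "j \<in> {1..8}" "k \<in> {1..8}" for i j k l
  proof -
    have "G i j ** G k l = transpose (B i) ** (B j ** transpose (B k)) ** B l"
      by (simp add: G_def matrix_mul_assoc)
    also have "B j ** transpose (B k) = (2 * d j k) *\<^sub>R mat 1 - B k ** transpose (B j)"
      using hurwitz_radon(2)[OF that] by (simp add: d_def)
    finally show ?thesis
      by (simp add: G_def matrix_mult_diff matrix_mult_scaleR matrix_mul_assoc)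
  qed
  have "G i j ** G k l = (2 * d j k) *\<^sub>R G i l - ((2 * d i k) *\<^sub>R mat 1 - G k i) ** G j l"
    using mid[of j k i l] sw[of i k] assms by simp
  also have "\<dots> = (2 * d j k) *\<^sub>R G i l - (2 * d i k) *\<^sub>R G j l
      + G k i ** ((2 * d j l) *\<^sub>R mat 1 - G l j)"
    unfolding sw[OF assms(2,4), symmetric] by (simp add: matrix_mult_diff matrix_mult_scaleR)
  also have "\<dots> = (2 * d j k) *\<^sub>R G i l - (2 * d i k) *\<^sub>R G j l
      + (2 * d j l) *\<^sub>R G k i - G k i ** G l j"
    by (simp add: matrix_mult_diff matrix_mult_scaleR)
  also have "G k i ** G l j = (2 * d i l) *\<^sub>R G k j - G k l ** G i j"
    using mid[of i l k j] assms by simp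
  finally have G: "G i j ** G k l - G k l ** G i j = (2 * d j k) *\<^sub>R G i l
      - (2 * d i k) *\<^sub>R G j l + (2 * d j l) *\<^sub>R G k i - (2 * d i l) *\<^sub>R G k j"
    by simp
  have e: "e i j = d i j *\<^sub>R mat 1 - G i j" for i j
    by (simp add: so8_gen_def G_def d_def)
  have "e i j ** e k l - e k l ** e i j = G i j ** G k l - G k l ** G i j"
    by (simp add: e matrix_mult_diff matrix_mult_scaleR scaleR_right_diff_distrib)
  also have "\<dots> = (if j = k then - 2 else 0) *\<^sub>R e i l + (if i = k then 2 else 0) *\<^sub>R e j l
    + (if j = l then - 2 else 0) *\<^sub>R e k i + (if i = l then 2 else 0) *\<^sub>R e k j"
    unfolding G e by (auto simp: d_def algebra_simps)
  finally show ?thesis .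
qed

lemma e_square:
  assumes "i \<in> {1..8}" "j \<in> {1..8}" "i \<noteq> j"
  shows "e i j ** e i j = - mat 1"
proof -
  have id: "transpose (B k) ** B k = mat 1" "B k ** transpose (B k) = mat 1"
    if "k \<in> {1..8}" for k
    by (rule B_cases[OF that]; simp add: matrix_mult_minus A_square)+
  have "e i j ** e i j = - (e i j ** e j i)"
    using e_swap[OF assms(1,2)] by (simp add: matrix_mult_minus)
  also have "e i j ** e j i = transpose (B i) ** (B j ** transpose (B j)) ** B i"
    using assms(3) by (simp add: so8_gen_def matrix_mult_minus matrix_mul_assoc)
  finally show ?thesis
    using assms by (simp add: id)
qed

lemma e_ne_0:
  assumes "i \<in> {1..8}" "j \<in> {1..8}" "i \<noteq> j"
  shows "e i j \<noteq> 0"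
proof
  assume "e i j = 0"
  then have "- mat 1 = (0 :: real^8^8)"
    using e_square[OF assms] by (simp add: matrix_matrix_mult_def vec_eq_iff)
  then show False
    by (simp add: vec_eq_iff mat_def split: if_splits)
qed

text \<open>Two of the \<open>e i j\<close> with different index pairs are told apart by their commutators with
  some \<open>e a m\<close>, where \<open>a\<close> occurs in only one of the pairs and \<open>m\<close> in neither.\<close>

lemma e_inj: "inj_on (\<lambda>(i, j). e i j) {(i, j). 1 \<le> i \<and> i < j \<and> j \<le> 8}"
proof -
  have ne: "e i j \<noteq> e k l"
    if "i \<in> {1..8}" "j \<in> {1..8}" "k \<in> {1..8}" "l \<in> {1..8}" "i \<noteq> j" "i \<noteq> k" "i \<noteq> l" for i j k l
  proof
    assume eq: "e i j = e k l"
    have "card {i, j, k, l} \<le> 4" by (simp add: card_insert_if)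
    then have "\<not> {1..8} \<subseteq> {i, j, k, l}"
      using card_mono[of "{i, j, k, l}" "{1..8::nat}"] by auto
    then obtain m where m: "m \<in> {1..8}" "m \<notin> {i, j, k, l}" by blast
    have "e i j ** e i m - e i m ** e i j = 2 *\<^sub>R e j m"
      using e_bracket[of i j i m] that m by simp
    moreover have "e k l ** e i m - e i m ** e k l = 0"
      using e_bracket[of k l i m] that m by simp
    ultimately show False
      using eq e_ne_0[of j m] that m by simp
  qed
  have "i = k \<and> j = l"
    if h: "1 \<le> i" "i < j" "j \<le> 8" "1 \<le> k" "k < l" "l \<le> 8" "e i j = e k l" for i j k l
  proof (rule ccontr)
    assume "\<not> ?thesis"
    then consider "i \<noteq> k" "i \<noteq> l" | "j \<noteq> k" "j \<noteq> l"
      using h by linarith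
    then show False
    proof cases
      case 1
      then show ?thesis using ne[of i j k l] h by simp
    next
      case 2
      then have "e j i \<noteq> e l k" using ne[of j i l k] h by simp
      then show ?thesis using e_swap[of i j] e_swap[of k l] h by simp
    qed
  qed
  then show ?thesis
    by (auto simp: inj_on_def)
qed

end

section \<open>Equality of the two so(4) blocks\<close>

lemma inner_matrix_vector: "(M *v x) \<bullet> y = x \<bullet> (transpose M *v y)" for M :: "real^'n^'m"
  using dot_lmul_matrix[of x "transpose M" y] transpose_matrix_vector[of "transpose M" x]
  by simp

context clifford_family
begin

definition a :: "nat \<Rightarrow> real^8 \<Rightarrow> real^8" where
  "a i x = A i *v x"

lemma a_linear [simp]:
  "a i (- x) = - a i x" "a i (x + y) = a i x + a i y" "a i (x - y) = a i x - a i y"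
  "a i (c *\<^sub>R x) = c *\<^sub>R a i x" "a i 0 = 0"
  by (simp_all add: a_def matrix_vector_right_distrib matrix_vector_mult_diff_distrib
      matrix_vector_mult_scaleR linear_neg)

lemma a_square: "i \<in> {1..7} \<Longrightarrow> a i (a i x) = - x"
  by (simp add: a_def matrix_vector_mul_assoc A_square matrix_vector_neg)

lemma a_anticommute: "i \<in> {1..7} \<Longrightarrow> j < i \<Longrightarrow> 1 \<le> j \<Longrightarrow> a i (a j x) = - a j (a i x)"
  using A_anticommute[of i j] by (simp add: a_def matrix_vector_mul_assoc matrix_vector_neg)

lemma inner_a: "i \<in> {1..7} \<Longrightarrow> a i x \<bullet> y = - (x \<bullet> a i y)"
  by (simp add: a_def inner_matrix_vector transpose_A matrix_vector_neg)

lemmas a_simps = a_square a_anticommute inner_a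

lemma inner_B:
  assumes "i \<in> {1..8}" "j \<in> {1..8}"
  shows "(B i *v x) \<bullet> (B j *v x) = (if i = j then x \<bullet> x else 0)"
proof -
  have *: "(B i *v x) \<bullet> (B j *v x) = x \<bullet> ((transpose (B i) ** B j) *v x)" for i j
    by (simp add: inner_matrix_vector flip: matrix_vector_mul_assoc)
  have "(B i *v x) \<bullet> (B j *v x) = (if i = j then 2 else 0) * (x \<bullet> x) - (B j *v x) \<bullet> (B i *v x)"
    using hurwitz_radon(1)[OF assms]
    by (simp add: * matrix_vector_mult_diff_rdistrib inner_diff_right
        flip: scaleR_matrix_vector_assoc)
  then show ?thesis
    by (auto simp: inner_commute split: if_splits)
qed

text \<open>The image of \<open>x\<close> under the volume element is orthogonal to every \<open>a i x\<close>, and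
  \<open>x\<close> together with the \<open>a i x\<close> is an orthogonal basis because the dimension is 8.\<close>

lemma volume_element:
  fixes x :: "real^8"
  defines "w \<equiv> a 1 (a 2 (a 3 (a 4 (a 5 (a 6 (a 7 x))))))"
  shows "w = x \<or> w = - x"
proof -
  \<comment> \<open>Up to sign, \<open>a i w\<close> is the product of the six other matrices
    applied to \<open>x\<close>. Transposing gives six signs and reversing the order gives fifteen,
    so this product is skew.\<close>
  have skew6: "x \<bullet> y = 0" if "y \<bullet> x = - (x \<bullet> y)" for y
    using that by (simp add: inner_commute)
  have w0: "a i x \<bullet> w = 0" if "i \<in> {1..7}" for i
  proof -
    have "i \<in> {1, 2, 3, 4, 5, 6, 7}" using that by auto
    then have "x \<bullet> a i w = 0"
      by (elim insertE emptyE; simp add: w_def a_simps; intro skew6; simp add: a_simps)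
    then show ?thesis using that by (simp add: inner_a)
  qed
  have ww: "w \<bullet> w = x \<bullet> x"
    by (simp add: w_def a_simps)
  \<comment> \<open>Parseval's identity in the frame \<open>B i *v x\<close>: only the term for the
    index 8 survives, which yields equality in the Cauchy-Schwarz inequality for \<open>x\<close>
    and \<open>w\<close>.\<close>
  have b: "bilinear (\<lambda>u v. (u \<bullet> w) * (v \<bullet> w))"
    by (auto simp: bilinear_def inner_add_left algebra_simps intro!: linearI)
  have "(\<Sum>i\<in>{1..8}. ((B i *v x) \<bullet> w) * ((B i *v x) \<bullet> w))
      = (x \<bullet> x) * (\<Sum>r\<in>UNIV. (axis r 1 \<bullet> w) * (axis r 1 \<bullet> w))"
    using inner_B by (intro sum_bilinear_orthogonal[OF b]) auto
  also have "(\<Sum>r\<in>UNIV. (axis r 1 \<bullet> w) * (axis r 1 \<bullet> w)) = w \<bullet> w"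
    by (simp add: inner_axis' inner_vec_def[of w w])
  also have "(\<Sum>i\<in>{1..8}. ((B i *v x) \<bullet> w) * ((B i *v x) \<bullet> w))
      = (\<Sum>i\<in>{1..8::nat}. if i = 8 then (x \<bullet> w)\<^sup>2 else 0)"
    using w0 by (intro sum.cong) (auto simp: unit_extend_def a_def power2_eq_square)
  finally have "(x \<bullet> w)\<^sup>2 = (x \<bullet> x)\<^sup>2"
    by (simp add: ww power2_eq_square)
  then consider "x \<bullet> w = x \<bullet> x" | "x \<bullet> w = - (x \<bullet> x)"
    by (auto simp: power2_eq_iff)
  then show ?thesis
  proof cases
    case 1
    then have "(w - x) \<bullet> (w - x) = 0" by (simp add: inner_diff ww inner_commute)
    then show ?thesis by simp
  next
    case 2
    then have "(w + x) \<bullet> (w + x) = 0" by (simp add: inner_add ww inner_commute)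
    then show ?thesis by (simp add: eq_neg_iff_add_eq_0)
  qed
qed

text \<open>A symmetric involution: transposing four skew anticommuting factors costs four signs and
  six exchanges. Hence every vector splits into components with eigenvalues 1 and -1.\<close>

definition chirality :: "real^8 \<Rightarrow> real^8" where
  "chirality x = a 1 (a 2 (a 3 (a 4 x)))"

text \<open>Both sides complete \<open>u, a 1 u, a 2 u, a 3 u, a 4 u\<close> to an orthogonal basis.\<close>

lemma sum_eigenspace:
  fixes b :: "real^8 \<Rightarrow> real^8 \<Rightarrow> real"
  assumes b: "bilinear b" and u: "chirality u = s *\<^sub>R u" and s: "s * s = 1"
  shows "b (a 1 (a 2 u)) (a 1 (a 2 u)) + b (a 1 (a 3 u)) (a 1 (a 3 u)) + b (a 1 (a 4 u)) (a 1 (a 4 u))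
    = b (a 5 u) (a 5 u) + b (a 6 u) (a 6 u) + b (a 7 u) (a 7 u)"
proof -
  \<comment> \<open>The shift by 4 places \<open>a 1 (a 2 u)\<close>, \<open>a 1 (a 3 u)\<close>,
    \<open>a 1 (a 4 u)\<close> at the positions 6, 7, 8.\<close>
  define v where "v i = (if i \<le> 4 then a i u else if i = 5 then u else a 1 (a (i - 4) u))" for i
  \<comment> \<open>\<open>chirality\<close> anticommutes with \<open>a i\<close> and commutes with
    \<open>a 1\<close> followed after \<open>a j\<close>, so the two vectors belong to the opposite
    eigenvalues \<open>- s\<close> and \<open>s\<close> of a symmetric map.\<close>
  have ort: "a i u \<bullet> a 1 (a j u) = 0" if "i \<in> {1..4}" "j \<in> {2..4}" for i j
  proof -
    have ij: "i \<in> {1, 2, 3, 4}" "j \<in> {2, 3, 4}" using that by auto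
    have "chirality (a 1 (a j u)) = a 1 (a j (chirality u))"
      using ij by (auto simp: chirality_def a_simps)
    moreover have "chirality (a i u) = - a i (chirality u)"
      using ij by (auto simp: chirality_def a_simps)
    moreover have "chirality (a i u) \<bullet> a 1 (a j u) = a i u \<bullet> chirality (a 1 (a j u))"
      by (simp add: chirality_def a_simps)
    ultimately have "s * (a i u \<bullet> a 1 (a j u)) = - (s * (a i u \<bullet> a 1 (a j u)))"
      by (simp only: u a_linear inner_minus_left inner_scaleR_left inner_scaleR_right)
    then show ?thesis using s by auto
  qed
  have uu: "a i u \<bullet> a j u = (if i = j then u \<bullet> u else 0)" if "i \<in> {1..7}" "j \<in> {1..7}" for i j
    using inner_B[of i j u] that by (simp add: unit_extend_def a_def)
  have u1: "u \<bullet> a i u = 0" "a i u \<bullet> u = 0" if "i \<in> {1..7}" for i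
    using inner_B[of i 8 u] that by (simp_all add: unit_extend_def a_def inner_commute)
  have u2: "a 1 (a i u) \<bullet> a 1 (a j u) = (if i = j then u \<bullet> u else 0)"
    if "i \<in> {2..4}" "j \<in> {2..4}" for i j
    using uu[of i j] inner_a[of 1 "a i u" "a 1 (a j u)"] a_square[of 1 "a j u"] that by simp
  have u3: "a 1 (a j u) \<bullet> u = 0" "u \<bullet> a 1 (a j u) = 0" if "j \<in> {2..4}" for j
    using uu[of 1 j] inner_a[of 1 u "a j u"] that by (simp_all add: inner_commute)
  have v: "v i \<bullet> v j = (if i = j then u \<bullet> u else 0)" if "i \<in> {1..8}" "j \<in> {1..8}" for i j
  proof -
    have "v i \<bullet> v j = (if i = j then u \<bullet> u else 0)" if "i \<in> {1..4}" "j \<in> {1..4}"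
      using uu[of i j] that by (simp add: v_def)
    moreover have "v i \<bullet> v j = 0 \<and> v j \<bullet> v i = 0" if "i \<in> {1..4}" "j = 5" for i j
      using u1[of i] that by (simp add: v_def)
    moreover have "v i \<bullet> v j = 0 \<and> v j \<bullet> v i = 0" if "i \<in> {1..4}" "j \<in> {6..8}" for i j
    proof -
      have "j - 4 \<in> {2..4}" using that by auto
      then have "v i \<bullet> v j = 0" using ort[of i "j - 4"] that by (simp add: v_def)
      then show ?thesis by (simp add: inner_commute)
    qed
    moreover have "v i \<bullet> v j = 0 \<and> v j \<bullet> v i = 0" if "i \<in> {6..8}" "j = 5" for i j
    proof -
      have "i - 4 \<in> {2..4}" using that by auto
      then show ?thesis using u3[of "i - 4"] that by (simp add: v_def)
    qed
    moreover have "v i \<bullet> v j = (if i = j then u \<bullet> u else 0)" if "i \<in> {6..8}" "j \<in> {6..8}"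
    proof -
      have "i - 4 \<in> {2..4}" "j - 4 \<in> {2..4}" "i - 4 = j - 4 \<longleftrightarrow> i = j" using that by auto
      then show ?thesis using u2[of "i - 4" "j - 4"] that by (simp add: v_def)
    qed
    moreover have "v 5 \<bullet> v 5 = u \<bullet> u" by (simp add: v_def)
    moreover have "i \<in> {1..4} \<or> i = 5 \<or> i \<in> {6..8}" "j \<in> {1..4} \<or> j = 5 \<or> j \<in> {6..8}"
      using that by auto
    moreover have "i \<noteq> j" if "i \<in> {1..4} \<and> j \<notin> {1..4} \<or> i = 5 \<and> j \<noteq> 5 \<or> i \<in> {6..8} \<and> j \<notin> {6..8}"
      using that by auto
    ultimately show ?thesis
      using that by (elim disjE) (auto simp del: atLeastAtMost_iff)
  qed
  have "(\<Sum>i\<in>{1..8}. b (v i) (v i)) = (\<Sum>i\<in>{1..8}. b (B i *v u) (B i *v u))"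
    using sum_bilinear_orthogonal[OF b, of "{1..8}" v "u \<bullet> u"] v
      sum_bilinear_orthogonal[OF b, of "{1..8}" "\<lambda>i. B i *v u" "u \<bullet> u"] inner_B by simp
  moreover have "{1..8} = {1, 2, 3, 4, 5, 6, 7, 8::nat}" by auto
  ultimately show ?thesis
    by (simp add: v_def unit_extend_def a_def)
qed

text \<open>Pairing each term with its complementary one gives values of \<open>q\<close> at images
  of \<open>x = u + v\<close> and of \<open>P = u - v\<close>. In each sum of two such values the
  mixed terms cancel by the parallelogram law, and \<open>sum_eigenspace\<close> applies to
  \<open>u\<close> and \<open>v\<close> separately.\<close>

lemma sum_blocks_eq:
  fixes b :: "real^8 \<Rightarrow> real^8 \<Rightarrow> real"
  assumes b: "bilinear b"
  defines "q \<equiv> \<lambda>x. b x x"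
  shows "q (a 1 (a 2 x)) + q (a 1 (a 3 x)) + q (a 1 (a 4 x))
      + q (a 2 (a 3 x)) + q (a 2 (a 4 x)) + q (a 3 (a 4 x))
    = q (a 5 x) + q (a 6 x) + q (a 7 x) + q (a 5 (a 6 x)) + q (a 5 (a 7 x)) + q (a 6 (a 7 x))"
proof -
  define P where "P = chirality x"
  define u where "u = (1 / 2) *\<^sub>R (x + P)"
  define v where "v = (1 / 2) *\<^sub>R (x - P)"
  have PP: "chirality P = x" by (simp add: P_def chirality_def a_simps)
  have lin: "chirality (c *\<^sub>R y) = c *\<^sub>R chirality y" "chirality (y + z) = chirality y + chirality z"
    "chirality (y - z) = chirality y - chirality z" "chirality (- y) = - chirality y" for c y z
    by (simp_all add: chirality_def)
  have u: "chirality u = 1 *\<^sub>R u" and v: "chirality v = (- 1) *\<^sub>R v"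
    by (simp_all add: u_def v_def lin PP P_def[symmetric] algebra_simps)
  have x: "x = u + v" and P: "P = u - v"
    by (simp_all add: u_def v_def vec_eq_iff field_simps)
  have qm: "q (- y) = q y" for y
    by (simp add: q_def bilinear_lneg[OF b] bilinear_rneg[OF b])
  have par: "q (y + z) + q (y - z) = 2 * (q y + q z)" for y z
    by (simp add: q_def bilinear_ladd[OF b] bilinear_radd[OF b] bilinear_lsub[OF b] bilinear_rsub[OF b])
  \<comment> \<open>Multiplying by \<open>chirality\<close> exchanges a pair of indices in 1 to 4
    with the complementary pair, up to a sign that the even function \<open>q\<close>
    ignores.\<close>
  have "q (a 3 (a 4 x)) = q (a 1 (a 2 P))" "q (a 2 (a 4 x)) = q (a 1 (a 3 P))"
    "q (a 2 (a 3 x)) = q (a 1 (a 4 P))"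
    by (simp_all add: P_def chirality_def a_simps qm)
  then have L: "q (a 1 (a 2 x)) + q (a 3 (a 4 x)) = 2 * (q (a 1 (a 2 u)) + q (a 1 (a 2 v)))"
    "q (a 1 (a 3 x)) + q (a 2 (a 4 x)) = 2 * (q (a 1 (a 3 u)) + q (a 1 (a 3 v)))"
    "q (a 1 (a 4 x)) + q (a 2 (a 3 x)) = 2 * (q (a 1 (a 4 u)) + q (a 1 (a 4 v)))"
    by (simp_all add: x P par)
  \<comment> \<open>The sign comes from \<open>volume_element\<close> at this particular
    \<open>x\<close>; evenness of \<open>q\<close> makes both values equally good.\<close>
  obtain t :: real where t: "t = 1 \<or> t = - 1" "chirality (a 5 (a 6 (a 7 x))) = t *\<^sub>R x"
    using volume_element[of x] unfolding chirality_def by force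
  have "a 5 (a 6 (a 7 x)) = chirality (chirality (a 5 (a 6 (a 7 x))))"
    by (simp add: chirality_def a_simps)
  also have "\<dots> = t *\<^sub>R P"
    using t(2) by (simp add: lin P_def)
  finally have "a 5 (a 6 (a 7 x)) = P \<or> a 5 (a 6 (a 7 x)) = - P"
    using t(1) by auto
  then have "q (a i (a 5 (a 6 (a 7 x)))) = q (a i P)" for i
    by (auto simp: qm)
  from this[of 5] this[of 6] this[of 7]
  have "q (a 6 (a 7 x)) = q (a 5 P)" "q (a 5 (a 7 x)) = q (a 6 P)" "q (a 5 (a 6 x)) = q (a 7 P)"
    by (simp_all add: a_simps qm)
  then have R: "q (a 5 x) + q (a 6 (a 7 x)) = 2 * (q (a 5 u) + q (a 5 v))"
    "q (a 6 x) + q (a 5 (a 7 x)) = 2 * (q (a 6 u) + q (a 6 v))"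
    "q (a 7 x) + q (a 5 (a 6 x)) = 2 * (q (a 7 u) + q (a 7 v))"
    by (simp_all add: x P par)
  show ?thesis
    using L R sum_eigenspace[OF b u] sum_eigenspace[OF b v] by (simp add: q_def)
qed

end

section \<open>Casimir operators\<close>

text \<open>Cutting off outside \<open>U\<close> turns identities that hold on \<open>U\<close> into equalities of functions.\<close>

definition X_on :: "(real^8) set \<Rightarrow> real^8^8 \<Rightarrow> (real^8 \<Rightarrow> real) \<Rightarrow> real^8 \<Rightarrow> real" where
  "X_on U E g x = (if x \<in> U then frechet_derivative g (at x) (E *v x) else 0)"

definition smooth_operator :: "(real^8) set \<Rightarrow> ((real^8 \<Rightarrow> real) \<Rightarrow> real^8 \<Rightarrow> real) \<Rightarrow> bool" where
  "smooth_operator U P \<longleftrightarrow>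
     (\<forall>f. smooth_on U f \<longrightarrow> smooth_on U (P f)) \<and>
     (\<forall>f g. smooth_on U f \<longrightarrow> smooth_on U g \<longrightarrow> P (\<lambda>x. f x + g x) = (\<lambda>x. P f x + P g x)) \<and>
     (\<forall>c f. smooth_on U f \<longrightarrow> P (\<lambda>x. c * f x) = (\<lambda>x. c * P f x))"

definition commute_on :: "(real^8) set \<Rightarrow> ((real^8 \<Rightarrow> real) \<Rightarrow> real^8 \<Rightarrow> real) \<Rightarrow>
    ((real^8 \<Rightarrow> real) \<Rightarrow> real^8 \<Rightarrow> real) \<Rightarrow> bool" where
  "commute_on U P Q \<longleftrightarrow> (\<forall>f. smooth_on U f \<longrightarrow> P (Q f) = Q (P f))"

lemma smooth_on_scale: "open U \<Longrightarrow> smooth_on U f \<Longrightarrow> smooth_on U (\<lambda>x. c * f x)"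
  by (intro smooth_on_mult smooth_on_const)

lemma smooth_operatorD:
  assumes "smooth_operator U P"
  shows "smooth_on U f \<Longrightarrow> smooth_on U (P f)"
    and "smooth_on U f \<Longrightarrow> smooth_on U g \<Longrightarrow> P (\<lambda>x. f x + g x) = (\<lambda>x. P f x + P g x)"
    and "smooth_on U f \<Longrightarrow> P (\<lambda>x. c * f x) = (\<lambda>x. c * P f x)"
  using assms unfolding smooth_operator_def by blast+

lemma smooth_operator_sum_arg:
  assumes U: "open U" and P: "smooth_operator U P" and f: "\<And>i. i \<in> I \<Longrightarrow> smooth_on U (f i)"
  shows "P (\<lambda>x. \<Sum>i\<in>I. f i x) = (\<lambda>x. \<Sum>i\<in>I. P (f i) x)"
proof -
  have zero: "P (\<lambda>x. 0) = (\<lambda>x. 0)"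
    using smooth_operatorD(3)[OF P, of "\<lambda>x. 0" 0] by (simp add: smooth_on_const)
  show ?thesis
    using f
  proof (induction I rule: infinite_finite_induct)
    case (insert i I)
    then have "P (\<lambda>x. f i x + (\<Sum>i\<in>I. f i x)) = (\<lambda>x. P (f i) x + P (\<lambda>x. \<Sum>i\<in>I. f i x) x)"
      by (intro smooth_operatorD(2)[OF P] smooth_on_sum U) auto
    then show ?case using insert by simp
  qed (simp_all add: zero)
qed

lemma smooth_operator_sum:
  assumes "open U" "\<And>i. i \<in> I \<Longrightarrow> smooth_operator U (P i)"
  shows "smooth_operator U (\<lambda>f x. \<Sum>i\<in>I. P i f x)"
proof -
  note D = smooth_operatorD[OF assms(2)]
  show ?thesis
    unfolding smooth_operator_def
    by (auto intro!: smooth_on_sum assms(1) D(1) simp: D(2,3) sum.distrib sum_distrib_left)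
qed

lemma smooth_operator_compose:
  assumes "smooth_operator U P" "smooth_operator U Q"
  shows "smooth_operator U (\<lambda>f. P (Q f))"
  using assms unfolding smooth_operator_def by simp

lemma smooth_operator_scale:
  assumes "open U" "smooth_operator U P"
  shows "smooth_operator U (\<lambda>f x. c * P f x)"
  using smooth_operatorD[OF assms(2)] smooth_on_scale[OF assms(1)]
  unfolding smooth_operator_def by (simp add: algebra_simps)

lemma smooth_operator_add:
  assumes "open U" "smooth_operator U P" "smooth_operator U Q"
  shows "smooth_operator U (\<lambda>f x. P f x + Q f x)"
  using smooth_operatorD[OF assms(2)] smooth_operatorD[OF assms(3)] smooth_on_add[OF assms(1)]
  unfolding smooth_operator_def by (simp add: algebra_simps)

lemma commute_on_sym: "commute_on U P Q \<Longrightarrow> commute_on U Q P"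
  by (simp add: commute_on_def)

lemma commute_on_compose:
  assumes "smooth_operator U Q" "smooth_operator U R" "commute_on U P Q" "commute_on U P R"
  shows "commute_on U P (\<lambda>f. Q (R f))"
  using assms smooth_operatorD(1) unfolding commute_on_def by metis

lemma commute_on_sum:
  assumes "open U" "smooth_operator U P" "\<And>i. i \<in> I \<Longrightarrow> smooth_operator U (Q i)"
    "\<And>i. i \<in> I \<Longrightarrow> commute_on U P (Q i)"
  shows "commute_on U P (\<lambda>f x. \<Sum>i\<in>I. Q i f x)"
  using assms(4) unfolding commute_on_def
  by (simp add: smooth_operator_sum_arg[OF assms(1,2)] smooth_operatorD(1)[OF assms(3)])

lemma commute_on_linear_combination:
  assumes U: "open U" and P: "smooth_operator U P" and Q: "smooth_operator U Q"
    and R: "smooth_operator U R" and comm: "commute_on U P Q" "commute_on U P R"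
  shows "commute_on U P (\<lambda>f x. c * Q f x + d * R f x)"
  unfolding commute_on_def
proof (intro allI impI)
  fix f assume f: "smooth_on U f"
  note Qf = smooth_operatorD(1)[OF Q f] and Rf = smooth_operatorD(1)[OF R f]
  have "P (\<lambda>x. c * Q f x + d * R f x) = (\<lambda>x. c * P (Q f) x + d * P (R f) x)"
    by (simp add: smooth_operatorD(2)[OF P] smooth_operatorD(3)[OF P] smooth_on_scale U Qf Rf)
  then show "P (\<lambda>x. c * Q f x + d * R f x) = (\<lambda>x. c * Q (P f) x + d * R (P f) x)"
    using comm f by (simp add: commute_on_def)
qed

section \<open>Linear vector fields on an open set and their brackets\<close>

context
  fixes U :: "(real^8) set"
  assumes U: "open U"
begin

abbreviation "X \<equiv> X_on U"

lemma X_on_eq_lin_vf: "smooth_on U g \<Longrightarrow> x \<in> U \<Longrightarrow> X E g x = lin_vf E g x"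
  by (simp add: X_on_def lin_vf_eq smooth_on_differentiable U)

lemma linear_derivative: "smooth_on U g \<Longrightarrow> x \<in> U \<Longrightarrow> linear (frechet_derivative g (at x))"
  by (simp add: linear_frechet_derivative smooth_on_differentiable U)

lemma smooth_on_X: "smooth_on U g \<Longrightarrow> smooth_on U (X E g)"
proof (rule smooth_on_cong[OF U])
  assume g: "smooth_on U g"
  have "smooth_on U (\<lambda>x :: real^8. x $ k)" for k
    by (intro smooth_on_bounded_linear bounded_linear_vec_nth)
  then show "smooth_on U (lin_vf E g)"
    unfolding lin_vf_def[abs_def]
    by (intro smooth_on_sum smooth_on_mult smooth_on_const smooth_on_frechet_derivative g U)
  show "lin_vf E g x = X E g x" if "x \<in> U" for x
    using X_on_eq_lin_vf[OF g that] by simp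
qed

lemma smooth_operator_X: "smooth_operator U (X E)"
proof -
  have "X E (\<lambda>x. f x + g x) x = X E f x + X E g x"
    if "smooth_on U f" "smooth_on U g" for f g x
    using that by (simp add: X_on_def frechet_derivative_add_mult smooth_on_differentiable[OF _ U])
  moreover have "X E (\<lambda>x. c * f x) x = c * X E f x" if "smooth_on U f" for c f x
    using that by (simp add: X_on_def frechet_derivative_add_mult smooth_on_differentiable[OF _ U])
  ultimately show ?thesis
    by (auto simp: smooth_operator_def smooth_on_X)
qed

lemmas X_smooth_operatorD = smooth_operatorD[OF smooth_operator_X]

lemma X_linear_matrix:
  assumes "smooth_on U g"
  shows "X (E + F) g = (\<lambda>x. X E g x + X F g x)" "X (c *\<^sub>R E) g = (\<lambda>x. c * X E g x)"
  using linear_derivative[OF assms]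
  by (auto simp: X_on_def fun_eq_iff matrix_vector_mult_add_rdistrib linear_add linear_cmul
      simp flip: scaleR_matrix_vector_assoc)

text \<open>The second term arises because the direction \<open>F *v y\<close> varies with the
  point. Expanding it in partial derivatives makes the product rule applicable, and freezing it at
  \<open>x\<close> isolates the Hessian term.\<close>

lemma X_X:
  assumes g: "smooth_on U g" and x: "x \<in> U"
  shows "X E (X F g) x = frechet_derivative (\<lambda>y. frechet_derivative g (at y) (F *v x)) (at x) (E *v x)
    + frechet_derivative g (at x) (F *v (E *v x))"
proof -
  define D where "D r y = frechet_derivative g (at y) (axis r 1)" for r y
  have axis: "frechet_derivative g (at y) z = (\<Sum>r\<in>UNIV. z $ r * D r y)" if "y \<in> U" for y z
  proof -
    interpret linear "frechet_derivative g (at y)" by (rule linear_derivative[OF g that])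
    have "frechet_derivative g (at y) (\<Sum>r\<in>UNIV. z $ r *\<^sub>R axis r 1) = (\<Sum>r\<in>UNIV. z $ r * D r y)"
      by (simp add: sum scaleR D_def)
    then show ?thesis
      using basis_expansion[of z] by (simp add: scalar_mult_eq_scaleR)
  qed
  have D: "(D r has_derivative frechet_derivative (D r) (at x)) (at x)" for r
    using smooth_on_differentiable[OF smooth_on_frechet_derivative[OF g] U x]
    by (simp add: frechet_derivative_works D_def[abs_def])
  have "((\<lambda>y. \<Sum>r\<in>UNIV. (F *v y) $ r * D r y) has_derivative
      (\<lambda>h. \<Sum>r\<in>UNIV. (F *v x) $ r * frechet_derivative (D r) (at x) h + (F *v h) $ r * D r x)) (at x)"
    by (intro has_derivative_sum has_derivative_mult D bounded_linear_imp_has_derivative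
        bounded_linear_compose[OF bounded_linear_vec_nth matrix_vector_mul_bounded_linear])
  then have "(X F g has_derivative
      (\<lambda>h. \<Sum>r\<in>UNIV. (F *v x) $ r * frechet_derivative (D r) (at x) h + (F *v h) $ r * D r x)) (at x)"
    by (rule has_derivative_transform_within_open[OF _ U x]) (simp add: X_on_def axis)
  then have 1: "X E (X F g) x = (\<Sum>r\<in>UNIV. (F *v x) $ r * frechet_derivative (D r) (at x) (E *v x))
      + frechet_derivative g (at x) (F *v (E *v x))"
    using x by (simp add: X_on_def[of U E] frechet_derivative_at[symmetric] sum.distrib axis)
  have "((\<lambda>y. \<Sum>r\<in>UNIV. (F *v x) $ r * D r y) has_derivative
      (\<lambda>h. \<Sum>r\<in>UNIV. (F *v x) $ r * frechet_derivative (D r) (at x) h)) (at x)"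
    by (intro has_derivative_sum has_derivative_mult_right D)
  then have "((\<lambda>y. frechet_derivative g (at y) (F *v x)) has_derivative
      (\<lambda>h. \<Sum>r\<in>UNIV. (F *v x) $ r * frechet_derivative (D r) (at x) h)) (at x)"
    by (rule has_derivative_transform_within_open[OF _ U x]) (simp add: axis)
  then show ?thesis
    using 1 by (simp add: frechet_derivative_at[symmetric])
qed

text \<open>The Hessian terms of the two orders cancel by symmetry. What remains has the matrices in
  reversed order: passing from matrices to vector fields is an antihomomorphism.\<close>

lemma X_bracket:
  assumes g: "smooth_on U g"
  shows "X E (X F g) = (\<lambda>x. X F (X E g) x + X (F ** E - E ** F) g x)"
proof
  fix x
  show "X E (X F g) x = X F (X E g) x + X (F ** E - E ** F) g x"
  proof (cases "x \<in> U")
    case True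
    then show ?thesis
      using linear_derivative[OF g True] second_derivative_symmetric[OF U True g]
      by (simp add: X_X[OF g True] X_on_def[of U "F ** E - E ** F"] matrix_vector_mult_diff_rdistrib
          linear_diff flip: matrix_vector_mul_assoc)
  qed (simp add: X_on_def)
qed

end

section \<open>Casimir operators of index sets and their commutation\<close>

lemma sum_symmetric_pairs:
  fixes \<phi> :: "nat \<Rightarrow> nat \<Rightarrow> real"
  assumes I: "finite I" and "\<And>i. i \<in> I \<Longrightarrow> \<phi> i i = 0"
    and "\<And>i j. i \<in> I \<Longrightarrow> j \<in> I \<Longrightarrow> \<phi> i j = \<phi> j i"
  shows "(\<Sum>i\<in>I. \<Sum>j\<in>I. \<phi> i j) = 2 * (\<Sum>(i, j)\<in>{(i, j). i \<in> I \<and> j \<in> I \<and> i < j}. \<phi> i j)"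
proof -
  let ?P = "{(i, j). i \<in> I \<and> j \<in> I \<and> i < j}" and ?Q = "{(i, j). i \<in> I \<and> j \<in> I \<and> j < i}"
  have fin: "finite ?P" "finite ?Q"
    by (rule finite_subset[of _ "I \<times> I"]; use I in auto)+
  have "(\<Sum>i\<in>I. \<Sum>j\<in>I. \<phi> i j) = (\<Sum>(i, j)\<in>I \<times> I. \<phi> i j)"
    by (simp add: sum.cartesian_product)
  also have "\<dots> = (\<Sum>(i, j)\<in>?P \<union> ?Q. \<phi> i j)"
    by (rule sum.mono_neutral_right) (use I assms(2) in \<open>auto simp: not_less order_le_less\<close>)
  also have "\<dots> = (\<Sum>(i, j)\<in>?P. \<phi> i j) + (\<Sum>(i, j)\<in>?Q. \<phi> i j)"
    using fin by (intro sum.union_disjoint) auto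
  also have "(\<Sum>(i, j)\<in>?Q. \<phi> i j) = (\<Sum>(i, j)\<in>?P. \<phi> i j)"
    by (rule sum.reindex_bij_witness[of _ prod.swap prod.swap]) (use assms(3) in auto)
  finally show ?thesis by simp
qed

context clifford_family
begin

text \<open>Ordered pairs keep the index sums free of case distinctions on the order of
  \<open>i\<close> and \<open>j\<close>. Each generator is counted twice, whence the factors 1/2
  further on.\<close>

definition casimir :: "(real^8) set \<Rightarrow> nat set \<Rightarrow> (real^8 \<Rightarrow> real) \<Rightarrow> real^8 \<Rightarrow> real" where
  "casimir U I g x = (\<Sum>i\<in>I. \<Sum>j\<in>I. X_on U (e i j) (X_on U (e i j) g) x)"

lemma smooth_operator_casimir: "open U \<Longrightarrow> smooth_operator U (casimir U I)"
  unfolding casimir_def[abs_def]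
  by (intro smooth_operator_sum smooth_operator_compose[OF smooth_operator_X smooth_operator_X])

text \<open>Invariance of a sum of squares: moving \<open>e k l\<close> past the squares leaves
  symmetrized products of \<open>e i j\<close> with its bracket. These vanish singly if
  \<open>k\<close> and \<open>l\<close> lie outside \<open>I\<close>, and cancel in the sum if both
  lie inside.\<close>

lemma casimir_commute_generator:
  assumes U: "open U" and I: "finite I" "I \<subseteq> {1..8}" and kl: "k \<in> {1..8}" "l \<in> {1..8}" "k \<in> I \<longleftrightarrow> l \<in> I"
  shows "commute_on U (casimir U I) (X_on U (e k l))"
  unfolding commute_on_def
proof (intro allI impI ext)
  fix g x assume g: "smooth_on U g"
  let ?X = "X_on U"
  note smooth = smooth_on_X[OF U] and lin = X_linear_matrix[OF U] and op = X_smooth_operatorD[OF U]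
  \<comment> \<open>The commutator of a square with another field is such a symmetrized product; its
    symmetry is what produces the cancellation.\<close>
  define T where "T E F = ?X E (?X F g) x + ?X F (?X E g) x" for E F
  have T_add: "T E (F + F') = T E F + T E F'" and T_scale: "T E (c *\<^sub>R F) = c * T E F" for E F F' c
    by (simp_all add: T_def lin g smooth op algebra_simps)
  have T_sym: "T E F = T F E" for E F by (simp add: T_def)
  have T_neg: "T E (- F) = - T E F" "T (- F) E = - T F E" for E F
    using T_scale[of E "- 1" F] T_sym by simp_all
  have T_0: "T E 0 = 0" for E using T_scale[of E 0 0] by simp
  define W where "W i j = e k l ** e i j - e i j ** e k l" for i j
  have W: "W i j = (if j = k then 2 else 0) *\<^sub>R e i l + (if i = k then - 2 else 0) *\<^sub>R e j l
      + (if j = l then 2 else 0) *\<^sub>R e k i + (if i = l then - 2 else 0) *\<^sub>R e k j"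
    if "i \<in> I" "j \<in> I" for i j
  proof -
    have "W i j = - (e i j ** e k l - e k l ** e i j)" by (simp add: W_def)
    also have "e i j ** e k l - e k l ** e i j = (if j = k then - 2 else 0) *\<^sub>R e i l
        + (if i = k then 2 else 0) *\<^sub>R e j l + (if j = l then - 2 else 0) *\<^sub>R e k i
        + (if i = l then 2 else 0) *\<^sub>R e k j"
      using that I kl by (intro e_bracket) blast+
    finally show ?thesis by simp
  qed
  have cube: "?X (e i j) (?X (e i j) (?X (e k l) g)) x
      = ?X (e k l) (?X (e i j) (?X (e i j) g)) x + T (e i j) (W i j)" for i j
    by (simp add: X_bracket[OF U, of _ "e i j" "e k l"] op g smooth T_def W_def)
  have "(\<Sum>i\<in>I. \<Sum>j\<in>I. T (e i j) (W i j)) = 0"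
  proof (cases "k \<in> I")
    case False
    then have "W i j = 0" if "i \<in> I" "j \<in> I" for i j
    proof -
      have "i \<noteq> k" "j \<noteq> k" "i \<noteq> l" "j \<noteq> l" using False kl(3) that by blast+
      then show ?thesis by (simp only: W[OF that]) simp
    qed
    then show ?thesis by (simp add: T_0)
  next
    case True
    have sw: "e k i = - e i k" "e l i = - e i l" if "i \<in> I" for i
      using that I kl by (intro e_swap; blast)+
    have delta: "(\<Sum>i\<in>I. \<Sum>j\<in>I. if j = m then f i else 0) = (\<Sum>i\<in>I. f i)"
      "(\<Sum>i\<in>I. \<Sum>j\<in>I. if i = m then f j else 0) = (\<Sum>j\<in>I. f j)" if "m \<in> I"
      for m and f :: "nat \<Rightarrow> real"
      using that I(1) by (simp, subst sum.swap) simp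
    have "(\<Sum>i\<in>I. \<Sum>j\<in>I. T (e i j) (W i j)) = (\<Sum>i\<in>I. \<Sum>j\<in>I.
        (if j = k then 2 * T (e i k) (e i l) else 0) + (if i = k then - 2 * T (e k j) (e j l) else 0)
        + (if j = l then 2 * T (e i l) (e k i) else 0) + (if i = l then - 2 * T (e l j) (e k j) else 0))"
      by (intro sum.cong refl) (auto simp: W T_add T_scale T_0)
    also have "\<dots> = (\<Sum>i\<in>I. 2 * T (e i k) (e i l)) + (\<Sum>j\<in>I. - 2 * T (e k j) (e j l))
        + (\<Sum>i\<in>I. 2 * T (e i l) (e k i)) + (\<Sum>j\<in>I. - 2 * T (e l j) (e k j))"
      using True kl(3) by (simp only: sum.distrib delta)
    \<comment> \<open>After antisymmetry of \<open>e\<close>, the four terms are multiples of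
      \<open>T (e i k) (e i l)\<close> with coefficients 2, 2, -2, -2.\<close>
    also have "\<dots> = (\<Sum>i\<in>I. 2 * T (e i k) (e i l) - 2 * T (e k i) (e i l)
        + 2 * T (e i l) (e k i) - 2 * T (e l i) (e k i))"
      by (simp add: sum.distrib sum_subtractf sum_negf)
    also have "\<dots> = 0"
      by (intro sum.neutral ballI) (simp add: sw T_neg T_sym)
    finally show ?thesis .
  qed
  moreover have "?X (e k l) (casimir U I g) x
      = (\<Sum>i\<in>I. \<Sum>j\<in>I. ?X (e k l) (?X (e i j) (?X (e i j) g)) x)"
    unfolding casimir_def[abs_def]
    by (simp add: smooth_operator_sum_arg[OF U smooth_operator_X[OF U]] smooth_on_sum U smooth g)
  ultimately show "casimir U I (?X (e k l) g) x = ?X (e k l) (casimir U I g) x"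
    by (simp add: casimir_def[of U I "?X (e k l) g"] cube sum.distrib)
qed

text \<open>In both cases two indices from \<open>J\<close> are together inside or together outside
  \<open>I\<close>, so the Casimir operator of \<open>I\<close> commutes with every generator of
  \<open>J\<close>.\<close>

lemma casimir_commute:
  assumes U: "open U" and "I \<subseteq> {1..8}" "J \<subseteq> {1..8}" "J \<subseteq> I \<or> I \<inter> J = {}"
  shows "commute_on U (casimir U I) (casimir U J)"
proof -
  have "finite I" using assms(2) finite_subset by blast
  then have "commute_on U (casimir U I) (X_on U (e i j))" if "i \<in> J" "j \<in> J" for i j
    using assms that by (intro casimir_commute_generator) auto
  then show ?thesis
    unfolding casimir_def[of U J, abs_def]
    by (intro commute_on_sum smooth_operator_sum U smooth_operator_casimir
        commute_on_compose[OF smooth_operator_X smooth_operator_X]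
        smooth_operator_compose[OF smooth_operator_X smooth_operator_X])
qed

lemma interval_1_4: "{1..4} = {1, 2, 3, 4 :: nat}" and interval_5_8: "{5..8} = {5, 6, 7, 8 :: nat}"
  by auto

definition pairs :: "nat set \<Rightarrow> (nat \<times> nat) set" where
  "pairs I = {(i, j). i \<in> I \<and> j \<in> I \<and> i < j}"

lemma finite_pairs: "finite I \<Longrightarrow> finite (pairs I)"
  by (rule finite_subset[of _ "I \<times> I"]) (auto simp: pairs_def)

lemma casimir_pairs:
  assumes U: "open U" and I: "I \<subseteq> {1..8}" and g: "smooth_on U g"
  shows "casimir U I g x = 2 * (\<Sum>(i, j)\<in>pairs I. X_on U (e i j) (X_on U (e i j) g) x)"
proof -
  have fin: "finite I" using I finite_subset by blast
  have neg: "X_on U (- E) f = (\<lambda>x. - X_on U E f x)" if "smooth_on U f" for E f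
    using X_linear_matrix(2)[OF U that, of "- 1" E] by simp
  have neg2: "X_on U E (\<lambda>x. - f x) = (\<lambda>x. - X_on U E f x)" if "smooth_on U f" for E f
    using X_smooth_operatorD(3)[OF U that, of E "- 1"] by simp
  have "X_on U 0 f = (\<lambda>x. 0)" if "smooth_on U f" for f
    using X_linear_matrix(2)[OF U that, of 0 0] by simp
  then have "X_on U (e i i) (X_on U (e i i) g) x = 0" if "i \<in> I" for i
    using e_refl[of i] that I smooth_on_X[OF U g] by auto
  moreover have "X_on U (e i j) (X_on U (e i j) g) x = X_on U (e j i) (X_on U (e j i) g) x"
    if "i \<in> I" "j \<in> I" for i j
  proof -
    have "e i j = - e j i" using that I by (intro e_swap; blast)
    then show ?thesis by (simp add: neg neg2 g smooth_on_X[OF U])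
  qed
  ultimately show ?thesis
    unfolding casimir_def pairs_def by (intro sum_symmetric_pairs fin)
qed

text \<open>Because \<open>e i j\<close> squares to minus the identity, its squared field is the
  Hessian along \<open>e i j *v x\<close> minus the radial derivative. Both blocks have six pairs,
  so the radial parts agree, and \<open>sum_blocks_eq\<close> for the Hessian settles the
  rest.\<close>

lemma casimir_blocks_eq:
  assumes U: "open U" and g: "smooth_on U g"
  shows "casimir U {5..8} g = casimir U {1..4} g"
proof
  fix x
  show "casimir U {5..8} g x = casimir U {1..4} g x"
  proof (cases "x \<in> U")
    case True
    define h where "h v w = frechet_derivative (\<lambda>y. frechet_derivative g (at y) v) (at x) w" for v w
    have lin: "linear (h v)" for v
      unfolding h_def by (intro linear_derivative[OF U _ True] smooth_on_frechet_derivative g)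
    moreover have "h v w = h w v" for v w
      unfolding h_def by (rule second_derivative_symmetric[OF U True g])
    ultimately have b: "bilinear h"
      unfolding bilinear_def by simp
    have sq: "X_on U (e i j) (X_on U (e i j) g) x = h (e i j *v x) (e i j *v x)
        - frechet_derivative g (at x) x" if "i \<in> {1..8}" "j \<in> {1..8}" "i \<noteq> j" for i j
      using X_X[OF U g True] e_square[OF that] linear_derivative[OF U g True]
      by (simp add: h_def matrix_vector_mul_assoc matrix_vector_neg linear_neg)
    have e: "e i j *v x = a i (a j x)" if "i \<in> {1..7}" "j \<in> {1..7}" "i \<noteq> j" for i j
      using e_A[OF that] by (simp add: a_def matrix_vector_mul_assoc)
    have e8: "e i 8 *v x = a i x" if "i \<in> {1..7}" for i
      using e_A8[OF that] by (simp add: a_def)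
    have "pairs {1..4} = {(1,2),(1,3),(1,4),(2,3),(2,4),(3,4)}"
      "pairs {5..8} = {(5,6),(5,7),(5,8),(6,7),(6,8),(7,8)}"
      by (simp_all only: interval_1_4 interval_5_8) (auto simp: pairs_def)
    then show ?thesis
      using sum_blocks_eq[OF b, of x]
      by (simp add: casimir_pairs[OF U _ g] sq e e8)
  qed (simp add: casimir_def X_on_def)
qed

end

section \<open>Operators on the sphere\<close>

text \<open>The neighbourhood \<open>U\<close> stays the same and the image is again a smooth
  extension; this is what allows operators to be iterated.\<close>

definition lifts :: "((real^8) set \<Rightarrow> (real^8 \<Rightarrow> real) \<Rightarrow> real^8 \<Rightarrow> real) \<Rightarrow>
    ((real^8 \<Rightarrow> real) \<Rightarrow> real^8 \<Rightarrow> real) \<Rightarrow> bool" where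
  "lifts Q P \<longleftrightarrow> (\<forall>f p U g. smooth_extension_at f p U g \<longrightarrow> smooth_extension_at (P f) p U (Q U g))"

lemma lifts_X_vf:
  assumes "skew_symmetric E"
  shows "lifts (\<lambda>U. X_on U E) (X_vf E)"
  unfolding lifts_def
proof (intro allI impI)
  fix f p U g assume g: "smooth_extension_at f p U g"
  \<comment> \<open>An extension at \<open>p\<close> also serves at every sphere point of
    \<open>U\<close>, so the values agree near \<open>p\<close> and the derivative can be
    differentiated again.\<close>
  have "X_vf E f q = X_on U E g q" if "q \<in> U \<inter> S7" for q
  proof -
    have "smooth_extension_at f q U g"
      using g that by (simp add: smooth_extension_at_def)
    then show ?thesis
      using X_vf_eq_lin_vf[OF assms, of q f U g] that
      by (simp add: X_on_eq_lin_vf smooth_extension_at_def)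
  qed
  then show "smooth_extension_at (X_vf E f) p U (X_on U E g)"
    using g by (simp add: smooth_extension_at_def smooth_on_X)
qed

lemma lifts_compose: "lifts P' P \<Longrightarrow> lifts Q' Q \<Longrightarrow> lifts (\<lambda>U f. P' U (Q' U f)) (\<lambda>f. P (Q f))"
  unfolding lifts_def by blast

lemma lifts_sum:
  assumes "\<And>i. i \<in> I \<Longrightarrow> lifts (P' i) (P i)"
  shows "lifts (\<lambda>U f x. \<Sum>i\<in>I. P' i U f x) (\<lambda>f x. \<Sum>i\<in>I. P i f x)"
  unfolding lifts_def
proof (intro allI impI)
  fix f p U g assume g: "smooth_extension_at f p U g"
  have "smooth_extension_at (P i f) p U (P' i U g)" if "i \<in> I" for i
    using assms[OF that] g unfolding lifts_def by blast
  then show "smooth_extension_at (\<lambda>x. \<Sum>i\<in>I. P i f x) p U (\<lambda>x. \<Sum>i\<in>I. P' i U g x)"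
    using g unfolding smooth_extension_at_def
    by (intro conjI smooth_on_sum ballI sum.cong) auto
qed

lemma lifts_minus:
  assumes "lifts P' P"
  shows "lifts (\<lambda>U f x. - P' U f x) (\<lambda>f x. - P f x)"
  unfolding lifts_def
proof (intro allI impI)
  fix f p U g assume g: "smooth_extension_at f p U g"
  then have "smooth_extension_at (P f) p U (P' U g)"
    using assms unfolding lifts_def by blast
  then show "smooth_extension_at (\<lambda>x. - P f x) p U (\<lambda>x. - P' U g x)"
    using smooth_on_scale[of U "P' U g" "- 1"] by (simp add: smooth_extension_at_def)
qed

lemma lifts_cong:
  assumes "lifts P' P" "\<And>U f x. open U \<Longrightarrow> smooth_on U f \<Longrightarrow> P' U f x = Q' U f x"
  shows "lifts Q' P"
  unfolding lifts_def
proof (intro allI impI)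
  fix f p U g assume g: "smooth_extension_at f p U g"
  then have "P' U g = Q' U g"
    using assms(2) by (auto simp: smooth_extension_at_def)
  then show "smooth_extension_at (P f) p U (Q' U g)"
    using g assms(1) unfolding lifts_def by metis
qed

text \<open>A single extension of \<open>f\<close> near \<open>p\<close> computes both composites,
  since lifted operators send extensions to extensions.\<close>

lemma commute_on_S7_lifts:
  assumes P: "lifts P' P" and Q: "lifts Q' Q" and comm: "\<And>U. open U \<Longrightarrow> commute_on U (P' U) (Q' U)"
  shows "commute_on_S7 P Q"
  unfolding commute_on_S7_def
proof (intro ballI)
  fix f p assume "f \<in> C_infinity_S7" and p: "p \<in> S7"
  then obtain U g where g: "smooth_extension_at f p U g"
    unfolding C_infinity_S7_def by blast
  have "smooth_extension_at (P (Q f)) p U (P' U (Q' U g))"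
    "smooth_extension_at (Q (P f)) p U (Q' U (P' U g))"
    using P Q g unfolding lifts_def by blast+
  then have "P (Q f) p = P' U (Q' U g) p" "Q (P f) p = Q' U (P' U g) p"
    using p by (auto simp: smooth_extension_at_def)
  moreover have "P' U (Q' U g) = Q' U (P' U g)"
    using comm[of U] g by (simp add: commute_on_def smooth_extension_at_def)
  ultimately show "P (Q f) p = Q (P f) p"
    by simp
qed

section \<open>The operators of the theorem as combinations of Casimir operators\<close>

context clifford_family
begin

text \<open>Injectivity of the indexing ensures that the sum over a set of matrices counts each
  index pair exactly once.\<close>

lemma sum_pairs_casimir:
  assumes "open U" "smooth_on U g" "I \<subseteq> {1..8}"
  shows "(\<Sum>E\<in>(\<lambda>(i, j). e i j) ` pairs I. X_on U E (X_on U E g) x) = casimir U I g x / 2"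
proof -
  have inj: "inj_on (\<lambda>(i, j). e i j) (pairs I)"
    by (rule inj_on_subset[OF e_inj]) (use assms(3) in \<open>fastforce simp: pairs_def\<close>)
  show ?thesis
    by (simp add: sum.reindex[OF inj] casimir_pairs[OF assms(1,3,2)]) (simp add: case_prod_beta)
qed

lemma sum_two_blocks_casimir:
  assumes "open U" "smooth_on U g" "I \<subseteq> {1..8}" "J \<subseteq> {1..8}" "I \<inter> J = {}"
  shows "(\<Sum>E\<in>(\<lambda>(i, j). e i j) ` (pairs I \<union> pairs J). X_on U E (X_on U E g) x)
    = casimir U I g x / 2 + casimir U J g x / 2"
proof -
  have "pairs I \<union> pairs J \<subseteq> {(i, j). 1 \<le> i \<and> i < j \<and> j \<le> 8}"
    using assms(3,4) by (fastforce simp: pairs_def)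
  then have "inj_on (\<lambda>(i, j). e i j) (pairs I \<union> pairs J)"
    by (rule inj_on_subset[OF e_inj])
  moreover have "pairs I \<inter> pairs J = {}"
    using assms(5) by (auto simp: pairs_def)
  \<comment> \<open>Injectivity on the union keeps the generators of the two blocks apart, so the
    sum splits.\<close>
  ultimately have "(\<lambda>(i, j). e i j) ` pairs I \<inter> (\<lambda>(i, j). e i j) ` pairs J = {}"
    unfolding inj_on_Un by (simp add: Diff_triv Int_commute)
  moreover have "finite (pairs I)" "finite (pairs J)"
    using assms(3,4) by (auto intro!: finite_pairs intro: finite_subset)
  ultimately show ?thesis
    using assms by (simp add: image_Un sum.union_disjoint sum_pairs_casimir)
qed

lemma image_pairs:
  assumes "I \<subseteq> {1..7}"
  shows "(\<lambda>(i, j). e i j) ` pairs I = {A i ** A j | i j. i \<in> I \<and> j \<in> I \<and> i < j}"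
proof -
  have "e i j = A i ** A j" if "(i, j) \<in> pairs I" for i j
    using that assms by (intro e_A) (auto simp: pairs_def)
  then have "(\<lambda>(i, j). e i j) ` pairs I = (\<lambda>(i, j). A i ** A j) ` pairs I"
    by (intro image_cong) auto
  then show ?thesis
    by (force simp: pairs_def)
qed

lemma pairs_insert_8: "I \<subseteq> {1..7} \<Longrightarrow> pairs (insert 8 I) = pairs I \<union> (\<lambda>i. (i, 8)) ` I"
  by (fastforce simp: pairs_def)

lemma image_pairs_8:
  assumes "I \<subseteq> {1..7}"
  shows "(\<lambda>(i, j). e i j) ` pairs (insert 8 I) = (\<lambda>(i, j). e i j) ` pairs I \<union> A ` I"
proof -
  have "(\<lambda>i. e i 8) ` I = A ` I"
    using assms by (intro image_cong refl e_A8) blast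
  then show ?thesis
    by (simp only: pairs_insert_8[OF assms] image_Un image_image) simp
qed

definition first_block :: "nat \<Rightarrow> nat set" where
  "first_block l = (if l = 1 then {1..2} else if l = 2 then {1..3} else if l = 7 then {1..8} else {1..4})"

text \<open>The empty default has Casimir operator zero and gives all \<open>H_op A l\<close> the
  same two-block shape.\<close>

definition second_block :: "nat \<Rightarrow> nat set" where
  "second_block l = (if l = 4 then {5..6} else if l = 5 then {5..7} else if l = 6 then {5..8} else {})"

lemma generating_set_eq:
  assumes "l \<in> {1..7}"
  shows "generating_set A l = (\<lambda>(i, j). e i j) ` (pairs (first_block l) \<union> pairs (second_block l))"
proof -
  have im: "(\<lambda>(i, j). e i j) ` pairs {m..n} = {A i ** A j | i j. m \<le> i \<and> i < j \<and> j \<le> n}"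
    if "1 \<le> m" "n \<le> 7" for m n
  proof -
    have "i \<in> {m..n} \<and> j \<in> {m..n} \<and> i < j \<longleftrightarrow> m \<le> i \<and> i < j \<and> j \<le> n" for i j
      by auto
    then show ?thesis
      using image_pairs[of "{m..n}"] that by simp
  qed
  have im8: "(\<lambda>(i, j). e i j) ` pairs {m..8} = {A i ** A j | i j. m \<le> i \<and> i < j \<and> j \<le> 7} \<union> A ` {m..7}"
    if "1 \<le> m" "m \<le> 7" for m
  proof -
    have "{m..8} = insert 8 {m..7}" using that by auto
    then show ?thesis
      using image_pairs_8[of "{m..7}"] im[of m 7] that by simp
  qed
  have two: "{A i ** A j | i j. (1 \<le> i \<and> i < j \<and> j \<le> 4) \<or> (5 \<le> i \<and> i < j \<and> j \<le> n)}
      = {A i ** A j | i j. 1 \<le> i \<and> i < j \<and> j \<le> 4} \<union> {A i ** A j | i j. 5 \<le> i \<and> i < j \<and> j \<le> n}"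
    for n
    by blast
  \<comment> \<open>The lone generator \<open>A 5 ** A 6\<close> is itself a block, that of the
    interval from 5 to 6.\<close>
  have 56: "(i, j) = (5, 6) \<longleftrightarrow> 5 \<le> i \<and> i < j \<and> j \<le> 6" for i j :: nat
    by auto
  have 567: "A ` {5..7} = {A 5, A 6, A 7}"
  proof -
    have "{5..7} = {5, 6, 7 :: nat}" by auto
    then show ?thesis by simp
  qed
  have 17: "A ` {1..7} = {A k | k. 1 \<le> k \<and> k \<le> 7}"
    by auto
  consider "l \<in> {1..3}" | "l = 4" | "l = 5" | "l = 6" | "l = 7"
    using assms by fastforce
  then show ?thesis
  proof cases
    case 1
    then have "first_block l = {1..l + 1}" "second_block l = {}"
      by (auto simp: first_block_def second_block_def)
    moreover have "pairs {} = {}" by (simp add: pairs_def)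
    moreover have "generating_set A l = {A i ** A j | i j. 1 \<le> i \<and> i < j \<and> j \<le> l + 1}"
      using 1 by (simp add: generating_set_def)
    ultimately show ?thesis
      using 1 im[of 1 "l + 1"] by simp
  next
    case 2
    have "generating_set A l = {A i ** A j | i j. (1 \<le> i \<and> i < j \<and> j \<le> 4) \<or> (i, j) = (5, 6)}"
      by (simp add: 2 generating_set_def)
    moreover have "first_block l = {1..4}" "second_block l = {5..6}"
      by (simp_all add: 2 first_block_def second_block_def)
    ultimately show ?thesis
      using two[of 6] im[of 1 4] im[of 5 6] by (simp only: 56 image_Un)
  next
    case 3
    have "generating_set A l =
        {A i ** A j | i j. (1 \<le> i \<and> i < j \<and> j \<le> 4) \<or> (5 \<le> i \<and> i < j \<and> j \<le> 7)}"
      by (simp add: 3 generating_set_def)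
    moreover have "first_block l = {1..4}" "second_block l = {5..7}"
      by (simp_all add: 3 first_block_def second_block_def)
    ultimately show ?thesis
      using two[of 7] im[of 1 4] im[of 5 7] by (simp only: image_Un)
  next
    case 4
    have "generating_set A l =
        {A i ** A j | i j. (1 \<le> i \<and> i < j \<and> j \<le> 4) \<or> (5 \<le> i \<and> i < j \<and> j \<le> 7)} \<union> {A 5, A 6, A 7}"
      by (simp add: 4 generating_set_def)
    moreover have "first_block l = {1..4}" "second_block l = {5..8}"
      by (simp_all add: 4 first_block_def second_block_def)
    ultimately show ?thesis
      using two[of 7] im[of 1 4] im8[of 5] 567 by (simp only: image_Un) (simp add: Un_assoc)
  next
    case 5
    have "generating_set A l =
        {A i ** A j | i j. 1 \<le> i \<and> i < j \<and> j \<le> 7} \<union> {A k | k. 1 \<le> k \<and> k \<le> 7}"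
      by (simp add: 5 generating_set_def)
    moreover have "first_block l = {1..8}" "second_block l = {}"
      by (simp_all add: 5 first_block_def second_block_def)
    moreover have "pairs {} = {}" by (simp add: pairs_def)
    ultimately show ?thesis
      using im8[of 1] 17 by (simp only: image_Un) simp
  qed
qed

lemma lifts_H_op:
  assumes "l \<in> {1..7}"
  shows "lifts (\<lambda>U g x. 1 / 2 * casimir U (first_block l) g x + 1 / 2 * casimir U (second_block l) g x)
    (H_op A l)"
proof -
  have blocks: "first_block l \<subseteq> {1..8}" "second_block l \<subseteq> {1..8}" "first_block l \<inter> second_block l = {}"
    by (auto simp: first_block_def second_block_def)
  have "skew_symmetric E" if "E \<in> generating_set A l" for E
  proof -
    obtain i j where ij: "E = e i j" "(i, j) \<in> pairs (first_block l) \<union> pairs (second_block l)"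
      using \<open>E \<in> generating_set A l\<close> generating_set_eq[OF assms] by auto
    then have "i \<in> {1..8}" "j \<in> {1..8}"
      using blocks unfolding pairs_def by blast+
    then show ?thesis using e_skew ij(1) by simp
  qed
  then have "lifts (\<lambda>U g x. \<Sum>E\<in>generating_set A l. X_on U E (X_on U E g) x) (H_op A l)"
    unfolding H_op_def[abs_def] by (intro lifts_sum lifts_compose[OF lifts_X_vf lifts_X_vf])
  then show ?thesis
    by (rule lifts_cong) (use blocks in \<open>simp add: generating_set_eq[OF assms] sum_two_blocks_casimir\<close>)
qed

text \<open>Adding the index 8 to the block of 1 to 4 adds exactly the generators
  \<open>e j 8 = A j\<close>, so the sum of their squares is half a difference of two Casimir
  operators.\<close>

lemma lifts_sublaplacian_T4:
  "lifts (\<lambda>U g x. 1 / 2 * casimir U {1..4} g x + (- 1 / 2) * casimir U (insert 8 {1..4}) g x)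
    (sublaplacian_T4 A)"
proof -
  have "lifts (\<lambda>U g x. - (\<Sum>j=1..4. X_on U (A j) (X_on U (A j) g) x)) (sublaplacian_T4 A)"
    unfolding sublaplacian_T4_def[abs_def]
    by (intro lifts_minus lifts_sum lifts_compose[OF lifts_X_vf lifts_X_vf] skew) auto
  then show ?thesis
  proof (rule lifts_cong)
    fix U :: "(real^8) set" and g x assume U: "open U" and g: "smooth_on U g"
    let ?\<phi> = "\<lambda>E. X_on U E (X_on U E g) x"
    have "pairs (insert 8 {1..4}) = pairs {1..4} \<union> (\<lambda>j. (j, 8)) ` {1..4}"
      by (intro pairs_insert_8) simp
    moreover have "pairs {1..4} \<inter> (\<lambda>j. (j, 8)) ` {1..4} = {}"
      by (auto simp: pairs_def)
    ultimately have "(\<Sum>(i, j)\<in>pairs (insert 8 {1..4}). ?\<phi> (e i j))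
        = (\<Sum>(i, j)\<in>pairs {1..4}. ?\<phi> (e i j)) + (\<Sum>(i, j)\<in>(\<lambda>j. (j, 8)) ` {1..4}. ?\<phi> (e i j))"
      by (simp add: sum.union_disjoint finite_pairs)
    also have "(\<Sum>(i, j)\<in>(\<lambda>j. (j, 8)) ` {1..4}. ?\<phi> (e i j)) = (\<Sum>j=1..4. ?\<phi> (A j))"
      by (subst sum.reindex) (auto simp: inj_on_def e_A8 intro!: sum.cong)
    finally show "- (\<Sum>j=1..4. ?\<phi> (A j))
        = 1 / 2 * casimir U {1..4} g x + (- 1 / 2) * casimir U (insert 8 {1..4}) g x"
      using casimir_pairs[OF U _ g, of "{1..4}" x] casimir_pairs[OF U _ g, of "insert 8 {1..4}" x]
      by (simp add: field_simps)
  qed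
qed

text \<open>Any two members are nested or disjoint. The block \<open>{5..8}\<close> is missing: it overlaps
  \<open>{1, 2, 3, 4, 8}\<close>, but its Casimir operator is that of \<open>{1..4}\<close>.\<close>

definition laminar :: "nat set set" where
  "laminar = {{1..2}, {1..3}, {1..4}, {5..6}, {5..7}, {1..8}, insert 8 {1..4}, {}}"

lemma casimir_commute_laminar:
  assumes U: "open U" and I: "I \<in> laminar" "J \<in> laminar"
  shows "commute_on U (casimir U I) (casimir U J)"
proof -
  \<comment> \<open>Explicit enumerations let simplification decide every pair of members.\<close>
  have intervals: "{1..2} = {1, 2 :: nat}" "{1..3} = {1, 2, 3 :: nat}" "{1..4} = {1, 2, 3, 4 :: nat}"
    "{5..6} = {5, 6 :: nat}" "{5..7} = {5, 6, 7 :: nat}" "{1..8} = {1, 2, 3, 4, 5, 6, 7, 8 :: nat}"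
    by auto
  have sub: "I \<subseteq> {1..8}" "J \<subseteq> {1..8}"
    using I by (auto simp: laminar_def)
  have "\<forall>I\<in>laminar. \<forall>J\<in>laminar. I \<subseteq> J \<or> J \<subseteq> I \<or> I \<inter> J = {}"
    unfolding laminar_def intervals by simp
  then have "I \<subseteq> J \<or> J \<subseteq> I \<or> I \<inter> J = {}"
    using I by blast
  then show ?thesis
    using casimir_commute[OF U sub] casimir_commute[OF U sub(2,1)] commute_on_sym by blast
qed

lemma commute_combinations:
  assumes "open U" "I \<in> laminar" "I' \<in> laminar" "J \<in> laminar" "J' \<in> laminar"
  shows "commute_on U (\<lambda>g x. c * casimir U I g x + c' * casimir U I' g x)
    (\<lambda>g x. d * casimir U J g x + d' * casimir U J' g x)"
  using assms
  by (intro commute_on_linear_combination smooth_operator_casimir smooth_operator_add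
      smooth_operator_scale commute_on_sym[OF commute_on_linear_combination]
      casimir_commute_laminar)

lemma lifts_H_op_laminar:
  assumes "l \<in> {1..7}"
  obtains I J where "I \<in> laminar" "J \<in> laminar"
    "lifts (\<lambda>U g x. 1 / 2 * casimir U I g x + 1 / 2 * casimir U J g x) (H_op A l)"
proof (cases "l = 6")
  case True
  \<comment> \<open>Replacing the block of 5 to 8 by that of 1 to 4 removes the only improper
    overlap; \<open>H_op A 6\<close> thereby has twice the lift of \<open>H_op A 3\<close>.\<close>
  have "lifts (\<lambda>U g x. 1 / 2 * casimir U {1..4} g x + 1 / 2 * casimir U {1..4} g x) (H_op A l)"
    by (rule lifts_cong[OF lifts_H_op[OF assms]])
      (simp add: True first_block_def second_block_def casimir_blocks_eq)
  then show ?thesis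
    by (rule that[rotated 2]) (simp_all add: laminar_def)
next
  case False
  then have "first_block l \<in> laminar" "second_block l \<in> laminar"
    by (auto simp: first_block_def second_block_def laminar_def)
  then show ?thesis
    using that lifts_H_op[OF assms] by blast
qed

lemma commute_H_op:
  assumes "l \<in> {1..7}" "m \<in> {1..7}"
  shows "commute_on_S7 (H_op A l) (H_op A m)"
  by (rule lifts_H_op_laminar[OF assms(1)], rule lifts_H_op_laminar[OF assms(2)])
    (blast intro: commute_on_S7_lifts commute_combinations)

lemma commute_H_op_sublaplacian_T4:
  assumes "l \<in> {1..7}"
  shows "commute_on_S7 (H_op A l) (sublaplacian_T4 A)"
proof -
  have "{1..4} \<in> laminar" "insert 8 {1..4} \<in> laminar"
    by (simp_all add: laminar_def)
  then show ?thesis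
    by (rule_tac lifts_H_op_laminar[OF assms])
      (blast intro: commute_on_S7_lifts[OF _ lifts_sublaplacian_T4] commute_combinations)
qed

end

theorem proposition6p3:
  fixes A :: "nat \<Rightarrow> real^8^8"
  assumes "\<And>i. i \<in> {1..7} \<Longrightarrow> skew_symmetric (A i)"
    and "\<And>i j. i \<in> {1..7} \<Longrightarrow> j \<in> {1..7} \<Longrightarrow>
           A i ** A j + A j ** A i = (- 2 * (if i = j then 1 else 0)) *\<^sub>R mat 1"
  shows "(\<forall>l\<in>{1..7}. \<forall>m\<in>{1..7}. commute_on_S7 (H_op A l) (H_op A m))
       \<and> (\<forall>l\<in>{1..7}. commute_on_S7 (H_op A l) (sublaplacian_T4 A))"
proof -
  interpret clifford_family A
    using assms by unfold_locales
  show ?thesis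
    using commute_H_op commute_H_op_sublaplacian_T4 by blast
qed

end
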